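(* For $n\geq 2$ let $\mathrm{Sym}^3(\mathbb{R}^{n+1})^*_{\mathrm{CCPSR}}\subset\mathrm{Sym}^3(\mathbb{R}^{n+1})^*$ denote the set of cubic homogeneous polynomials $h$ in $n+1$ real variables such that $\{h=1\}$ contains an $n$-dimensional CCPSR manifold, and let $\mathrm{Sym}^3(\mathbb{R}^{n+1})^*_{\mathrm{CCPSR,\ reg.}}\subset\mathrm{Sym}^3(\mathbb{R}^{n+1})^*_{\mathrm{CCPSR}}$ denote the subset of those $h$ such that $\{h=1\}$ contains an $n$-dimensional CCPSR manifold with regular boundary behaviour. Let $\overline{h}\in\mathrm{Sym}^3(\mathbb{R}^{n+1})^*_{\mathrm{CCPSR}}$ be $$\overline{h}=x^3-x(\langle s,s\rangle+w^2)-\frac{1}{\sqrt{3}}\langle s,s\rangle w-\frac{2}{3\sqrt{3}}w^3,$$ where $(x,s,w)=(x,s_1,\ldots,s_{n-1},w)$ are linear coordinates on $\mathbb{R}^{n+1}$. Then in the quotient topology of $\mathrm{Sym}^3(\mathbb{R}^{n+1})^*_{\mathrm{CCPSR}}/\mathrm{GL}(n+1)$, the point $[\overline{h}]$ cannot be separated from any point in $\mathrm{Sym}^3(\mathbb{R}^{n+1})^*_{\mathrm{CCPSR,\ reg.}}/\mathrm{GL}(n+1)$ with disjoint open sets.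
   Context: Let $h:\mathbb{R}^{n+1}\to\mathbb{R}$ be a cubic homogeneous polynomial. A point $p\in\{h>0\}$ is a hyperbolic point of $h$ if the negative Hessian $-\partial^2h_p$ has Lorentz signature ($n$ positive, one negative eigenvalue); $h$ is hyperbolic if it has a hyperbolic point. A projective special real (PSR) manifold of dimension $n$ is a smooth hypersurface $\mathcal{H}\subset\mathbb{R}^{n+1}$ contained in $\{h=1\}$ for a hyperbolic cubic homogeneous polynomial $h$ and consisting only of hyperbolic points of $h$. A CCPSR manifold is a PSR manifold that is connected and closed as a subset of $\mathbb{R}^{n+1}$. A CCPSR manifold $\mathcal{H}\subset\{h=1\}$ is singular at infinity if there is $p\in\partial(\mathbb{R}_{>0}\cdot\mathcal{H})\setminus\{0\}$ with $\mathrm{d}h_p=0$. It has regular boundary behaviour if it is not singular at infinity and, for all $p\in\partial(\mathbb{R}_{>0}\cdot\mathcal{H})\setminus\{0\}$, the restriction of $-\partial^2h_p$ to $T_p(\partial(\mathbb{R}_{>0}\cdot\mathcal{H})\setminus\{0\})$ is positive semi-definite with one-dimensional kernel. $\mathrm{GL}(n+1)$ acts on cubic homogeneous polynomials by linear changes of coordinates, $h\mapsto h\circ A$. The set $\mathrm{Sym}^3(\mathbb{R}^{n+1})^*_{\mathrm{CCPSR}}$ carries the subspace topology of the finite-dimensional real vector space $\mathrm{Sym}^3(\mathbb{R}^{n+1})^*$, and its orbit space the quotient topology. $\langle\cdot,\cdot\rangle$ is the standard Euclidean scalar product. *)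

theory Defs
  imports "HOL-Analysis.Analysis"
begin

text \<open>
  The ambient space \<open>\<real>\<^sup>n\<^sup>+\<^sup>1\<close> is an arbitrary Euclidean space \<open>'a\<close> with \<open>DIM('a) = n + 1\<close>.
\<close>

definition cubic_form :: "('a::euclidean_space \<Rightarrow> real) \<Rightarrow> bool" where
  "cubic_form h \<longleftrightarrow> real_polynomial_function h \<and> (\<forall>c x. h (c *\<^sub>R x) = c ^ 3 * h x)"

definition hessian :: "('a::euclidean_space \<Rightarrow> real) \<Rightarrow> 'a \<Rightarrow> 'a \<Rightarrow> 'a \<Rightarrow> real" where
  "hessian h p u v =
     frechet_derivative (\<lambda>x. frechet_derivative h (at x) v) (at p) u"

text \<open>
  \<open>\<mu> e\<close> is the eigenvalue belonging to \<open>e\<close> of the symmetric matrix that represents \<open>B\<close> with respect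
  to the Euclidean inner product; counting over an orthonormal eigenbasis counts eigenvalues
  with multiplicity.
\<close>

definition lorentz_signature :: "('a::euclidean_space \<Rightarrow> 'a \<Rightarrow> real) \<Rightarrow> bool" where
  "lorentz_signature B \<longleftrightarrow>
     (\<exists>E \<mu>. pairwise orthogonal E \<and> (\<forall>e\<in>E. norm e = 1) \<and> span E = UNIV \<and>
        (\<forall>e\<in>E. \<forall>v. B e v = \<mu> e * (e \<bullet> v)) \<and>
        card {e \<in> E. \<mu> e > 0} = DIM('a) - 1 \<and> card {e \<in> E. \<mu> e < 0} = 1)"

definition hyperbolic_point :: "('a::euclidean_space \<Rightarrow> real) \<Rightarrow> 'a \<Rightarrow> bool" where
  "hyperbolic_point h p \<longleftrightarrow> h p > 0 \<and> lorentz_signature (\<lambda>u v. - hessian h p u v)"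

definition hyperbolic :: "('a::euclidean_space \<Rightarrow> real) \<Rightarrow> bool" where
  "hyperbolic h \<longleftrightarrow> (\<exists>p. hyperbolic_point h p)"

text \<open>
  \<open>C\<^sup>k\<close> on an open set \<open>U\<close>, phrased through iterated directional derivatives.
\<close>

primrec Ck_on :: "nat \<Rightarrow> 'a::euclidean_space set \<Rightarrow> ('a \<Rightarrow> real) \<Rightarrow> bool" where
  "Ck_on 0 U f \<longleftrightarrow> continuous_on U f"
| "Ck_on (Suc k) U f \<longleftrightarrow>
     f differentiable_on U \<and> (\<forall>v. Ck_on k U (\<lambda>x. frechet_derivative f (at x) v))"

definition smooth_on :: "'a::euclidean_space set \<Rightarrow> ('a \<Rightarrow> real) \<Rightarrow> bool" where
  "smooth_on U f \<longleftrightarrow> (\<forall>k. Ck_on k U f)"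

definition smooth_hypersurface :: "'a::euclidean_space set \<Rightarrow> bool" where
  "smooth_hypersurface S \<longleftrightarrow>
     (\<forall>p\<in>S. \<exists>U F. open U \<and> p \<in> U \<and> smooth_on U F \<and>
        (\<forall>x\<in>U. frechet_derivative F (at x) \<noteq> (\<lambda>v. 0)) \<and>
        S \<inter> U = {x \<in> U. F x = 0})"

text \<open>
  \<open>connected {}\<close> and \<open>closed {}\<close> hold, so manifolds have to be required to be nonempty: otherwise
  every level set of a hyperbolic cubic would contain a CCPSR manifold.
\<close>

definition psr_manifold :: "('a::euclidean_space \<Rightarrow> real) \<Rightarrow> 'a set \<Rightarrow> bool" where
  "psr_manifold h H \<longleftrightarrow>
     cubic_form h \<and> hyperbolic h \<and> H \<noteq> {} \<and> smooth_hypersurface H \<and>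
     H \<subseteq> {x. h x = 1} \<and> (\<forall>p\<in>H. hyperbolic_point h p)"

definition ccpsr_manifold :: "('a::euclidean_space \<Rightarrow> real) \<Rightarrow> 'a set \<Rightarrow> bool" where
  "ccpsr_manifold h H \<longleftrightarrow> psr_manifold h H \<and> connected H \<and> closed H"

definition pos_cone :: "'a::euclidean_space set \<Rightarrow> 'a set" where
  "pos_cone H = {r *\<^sub>R x | r x. r > 0 \<and> x \<in> H}"

definition singular_at_infinity :: "('a::euclidean_space \<Rightarrow> real) \<Rightarrow> 'a set \<Rightarrow> bool" where
  "singular_at_infinity h H \<longleftrightarrow>
     (\<exists>p \<in> frontier (pos_cone H) - {0}. frechet_derivative h (at p) = (\<lambda>v. 0))"

text \<open>
  Velocities of curves in \<open>S\<close>; for an embedded submanifold this is the usual tangent space.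
\<close>

definition tangent_space :: "'a::euclidean_space set \<Rightarrow> 'a \<Rightarrow> 'a set" where
  "tangent_space S p =
     {v. \<exists>\<epsilon> \<gamma>. \<epsilon> > 0 \<and> \<gamma> C1_differentiable_on {-\<epsilon><..<\<epsilon>} \<and> \<gamma> ` {-\<epsilon><..<\<epsilon>} \<subseteq> S \<and>
        \<gamma> 0 = p \<and> (\<gamma> has_vector_derivative v) (at 0)}"

definition psd_one_dim_kernel_on :: "'a::euclidean_space set \<Rightarrow> ('a \<Rightarrow> 'a \<Rightarrow> real) \<Rightarrow> bool" where
  "psd_one_dim_kernel_on T B \<longleftrightarrow>
     (\<forall>u\<in>T. B u u \<ge> 0) \<and> dim {u \<in> T. \<forall>v\<in>T. B u v = 0} = 1"

definition regular_boundary_behaviour :: "('a::euclidean_space \<Rightarrow> real) \<Rightarrow> 'a set \<Rightarrow> bool" where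
  "regular_boundary_behaviour h H \<longleftrightarrow>
     \<not> singular_at_infinity h H \<and>
     (\<forall>p \<in> frontier (pos_cone H) - {0}.
        psd_one_dim_kernel_on (tangent_space (frontier (pos_cone H) - {0}) p)
          (\<lambda>u v. - hessian h p u v))"

definition sym3_ccpsr :: "('a::euclidean_space \<Rightarrow> real) set" where
  "sym3_ccpsr = {h. cubic_form h \<and> (\<exists>H. ccpsr_manifold h H)}"

definition sym3_ccpsr_reg :: "('a::euclidean_space \<Rightarrow> real) set" where
  "sym3_ccpsr_reg =
     {h. cubic_form h \<and> (\<exists>H. ccpsr_manifold h H \<and> regular_boundary_behaviour h H)}"

definition gl_orbit :: "('a::euclidean_space \<Rightarrow> real) \<Rightarrow> ('a \<Rightarrow> real) set" where
  "gl_orbit h = {h \<circ> A | A. linear A \<and> bij A}"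

definition quotient_topology :: "'a topology \<Rightarrow> ('a \<Rightarrow> 'b) \<Rightarrow> 'b topology" where
  "quotient_topology X f =
     topology (\<lambda>U. U \<subseteq> f ` topspace X \<and> openin X {x \<in> topspace X. f x \<in> U})"

lemma openin_quotient_topology:
  "openin (quotient_topology X f) U \<longleftrightarrow>
     U \<subseteq> f ` topspace X \<and> openin X {x \<in> topspace X. f x \<in> U}"
proof -
  let ?P = "\<lambda>U. U \<subseteq> f ` topspace X \<and> openin X {x \<in> topspace X. f x \<in> U}"
  have "istopology ?P"
    unfolding istopology_def
  proof (intro conjI allI impI)
    fix S T assume S: "?P S" and T: "?P T"
    show "S \<inter> T \<subseteq> f ` topspace X" using S by blast
    have "{x \<in> topspace X. f x \<in> S \<inter> T}
        = {x \<in> topspace X. f x \<in> S} \<inter> {x \<in> topspace X. f x \<in> T}" by blast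
    then show "openin X {x \<in> topspace X. f x \<in> S \<inter> T}"
      using S T by (simp add: openin_Int)
  next
    fix K assume K: "\<forall>S\<in>K. ?P S"
    then show "\<Union>K \<subseteq> f ` topspace X" by blast
    have "{x \<in> topspace X. f x \<in> \<Union>K} = (\<Union>S\<in>K. {x \<in> topspace X. f x \<in> S})" by blast
    then show "openin X {x \<in> topspace X. f x \<in> \<Union>K}"
      using K by auto
  qed
  then show ?thesis by (simp add: quotient_topology_def topology_inverse')
qed

lemma topspace_quotient_topology: "topspace (quotient_topology X f) = f ` topspace X"
proof -
  have "{x \<in> topspace X. f x \<in> f ` topspace X} = topspace X" by blast
  then have "openin (quotient_topology X f) (f ` topspace X)"
    by (simp add: openin_quotient_topology)
  then show ?thesis
    by (metis openin_quotient_topology openin_subset openin_topspace subset_antisym)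
qed

lemma quotient_map_quotient_topology: "quotient_map X (quotient_topology X f) f"
  by (auto simp: quotient_map_def topspace_quotient_topology openin_quotient_topology)

text \<open>
  The function type carries the topology of pointwise convergence. It is a Hausdorff vector space
  topology, so on the finite-dimensional subspace of cubic forms it is the standard topology.
  Orbits of elements of \<open>sym3_ccpsr\<close> lie in \<open>sym3_ccpsr\<close>, so they are the points of the orbit space.
\<close>

definition ccpsr_orbit_space :: "('a::euclidean_space \<Rightarrow> real) set topology" where
  "ccpsr_orbit_space = quotient_topology (top_of_set sym3_ccpsr) gl_orbit"

text \<open>
  The coordinates \<open>(x, s, w)\<close> live in \<open>\<real> \<times> \<real>\<^sup>n\<^sup>-\<^sup>1 \<times> \<real>\<close>, so \<open>n = CARD('k) + 1\<close>. As \<open>CARD('k)\<close> ranges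
  over all positive naturals, \<open>n\<close> ranges over all naturals \<open>\<ge> 2\<close>.
\<close>

definition hbar :: "real \<times> (real ^ 'k) \<times> real \<Rightarrow> real" where
  "hbar = (\<lambda>(x, s, w). x ^ 3 - x * (s \<bullet> s + w ^ 2)
             - 1 / sqrt 3 * (s \<bullet> s) * w - 2 / (3 * sqrt 3) * w ^ 3)"

end

theory Submission
  imports Defs
begin

text \<open>
  The polynomial \<open>hbar\<close> lies in the closure of the orbit of every regular \<open>h\<close>. Hence each
  saturated open set around \<open>hbar\<close> meets, and so contains, the orbit of \<open>h\<close>, and a neighbourhood
  of \<open>[hbar]\<close> in the orbit space contains \<open>[h]\<close>. So the task is to find linear bijections \<open>A\<^sub>n\<close>
  such that \<open>h \<circ> A\<^sub>n\<close> converges to \<open>hbar\<close>.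

  They come from zooming in on a boundary point. Let \<open>U\<close> be the cone over the manifold, and let
  \<open>p \<noteq> 0\<close> be a boundary point of \<open>U\<close>. Then \<open>h p = 0\<close>, and regularity says that \<open>dh\<close> is nonzero at \<open>p\<close>
  and that the negative Hessian at \<open>p\<close> is semidefinite with one-dimensional kernel on the tangent space \<open>K\<close>
  of the boundary, which is the kernel of \<open>dh\<close> at \<open>p\<close>
  (\<open>tangent_space_frontier\<close>). As \<open>p\<close> itself spans the kernel of the form, there are coordinates \<open>(a, s, b)\<close>,
  with \<open>p\<close> the first basis vector and \<open>K = {b = 0}\<close>, in which
  \<open>h = a\<^sup>2 b - a \<langle>s, s\<rangle> + (terms a b s, a b\<^sup>2, and cubic terms in s and b)\<close> (\<open>boundary_frame\<close>). Substituting
  \<open>(a / l\<^sup>2, l s, l\<^sup>4 b)\<close> leaves the first two terms unchanged, and as \<open>l\<close> tends to \<open>0\<close> all others vanish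
  (\<open>degeneration_to_model\<close>). The limit \<open>a\<^sup>2 b - a \<langle>s, s\<rangle>\<close> is \<open>hbar\<close> in other coordinates (\<open>hbar_eq_model\<close>).

  The topology on the orbit space is that of \<open>sym3_ccpsr\<close> and not of all cubic forms, so \<open>sym3_ccpsr\<close>
  has to be shown invariant under linear changes of coordinates. This rests on a description of
  Lorentz signature without eigenvalues (\<open>lorentz_signature_iff\<close>) and of CCPSR manifolds without
  local equations (\<open>sym3_ccpsr_iff\<close>). The latter needs that \<open>U\<close> is open (\<open>open_pos_cone\<close>). The tangent
  space at \<open>p\<close> is computed from the fact that \<open>U\<close> is a union of components of \<open>{h > 0}\<close>
  (\<open>connected_subset_pos_cone\<close>).
\<close>

section \<open>Derivatives of polynomial functions\<close>

text \<open>
  Directional derivatives of a polynomial are polynomials again. This makes polynomials smooth, and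
  it allows the first and second derivatives of a cubic form to be differentiated once more.
\<close>

lemma polynomial_derivative_ex:
  fixes f :: "'a::euclidean_space \<Rightarrow> real"
  assumes "real_polynomial_function f"
  shows "\<exists>D. (\<forall>x. (f has_derivative D x) (at x)) \<and> (\<forall>v. real_polynomial_function (\<lambda>x. D x v))"
  using assms
proof (induction rule: real_polynomial_function.induct)
  case (linear f)
  then show ?case
    by (intro exI[of _ "\<lambda>x. f"]) (auto intro: bounded_linear_imp_has_derivative)
next
  case (const c)
  show ?case by (intro exI[of _ "\<lambda>x v. 0"]) auto
next
  case (add f g)
  then obtain D E where "\<forall>x. (f has_derivative D x) (at x)" "\<forall>v. real_polynomial_function (\<lambda>x. D x v)"
    "\<forall>x. (g has_derivative E x) (at x)" "\<forall>v. real_polynomial_function (\<lambda>x. E x v)" by blast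
  then show ?case
    by (intro exI[of _ "\<lambda>x v. D x v + E x v"]) (auto intro!: has_derivative_add)
next
  case (mult f g)
  then obtain D E where "\<forall>x. (f has_derivative D x) (at x)" "\<forall>v. real_polynomial_function (\<lambda>x. D x v)"
    "\<forall>x. (g has_derivative E x) (at x)" "\<forall>v. real_polynomial_function (\<lambda>x. E x v)" by blast
  then show ?case using mult.hyps
    by (intro exI[of _ "\<lambda>x v. f x * E x v + D x v * g x"]) (auto intro!: has_derivative_mult real_polynomial_function.intros(3,4))
qed

lemma polynomial_has_derivative:
  fixes f :: "'a::euclidean_space \<Rightarrow> real"
  assumes "real_polynomial_function f"
  shows "(f has_derivative frechet_derivative f (at x)) (at x)"
  using polynomial_derivative_ex[OF assms] frechet_derivative_works differentiable_def by blast

lemma polynomial_frechet_derivative: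
  fixes f :: "'a::euclidean_space \<Rightarrow> real"
  assumes "real_polynomial_function f"
  shows "real_polynomial_function (\<lambda>x. frechet_derivative f (at x) v)"
proof -
  obtain D where "\<forall>x. (f has_derivative D x) (at x)" "\<forall>v. real_polynomial_function (\<lambda>x. D x v)"
    using polynomial_derivative_ex[OF assms] by blast
  moreover from this have "frechet_derivative f (at x) = D x" for x
    by (metis frechet_derivative_at)
  ultimately show ?thesis by simp
qed

lemma polynomial_continuous_on:
  fixes f :: "'a::euclidean_space \<Rightarrow> real"
  assumes "real_polynomial_function f"
  shows "continuous_on S f"
  by (meson polynomial_has_derivative[OF assms] has_derivative_continuous continuous_at_imp_continuous_on)

lemma polynomial_smooth_on:
  fixes f :: "'a::euclidean_space \<Rightarrow> real"
  assumes "real_polynomial_function f"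
  shows "smooth_on U f"
proof -
  have "Ck_on k U f" for k
    using assms
  proof (induction k arbitrary: f)
    case 0
    then show ?case by (simp add: polynomial_continuous_on)
  next
    case (Suc k)
    moreover have "f differentiable_on U"
      by (meson Suc.prems polynomial_has_derivative differentiableI differentiable_at_imp_differentiable_on)
    ultimately show ?case by (simp add: polynomial_frechet_derivative)
  qed
  then show ?thesis by (simp add: smooth_on_def)
qed

section \<open>The symmetric trilinear form of a cubic\<close>

text \<open>
  Differentiation lowers the degree of homogeneity by one. Two applications to a cubic form leave
  functions of degree one.
\<close>

lemma frechet_derivative_homogeneous:
  fixes f :: "'a::euclidean_space \<Rightarrow> real"
  assumes f: "real_polynomial_function f"
    and hom: "\<And>c x. c \<noteq> 0 \<Longrightarrow> f (c *\<^sub>R x) = c ^ Suc n * f x" and "c \<noteq> 0"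
  shows "frechet_derivative f (at (c *\<^sub>R x)) v = c ^ n * frechet_derivative f (at x) v"
proof -
  have "((\<lambda>x. f (c *\<^sub>R x)) has_derivative (\<lambda>v. frechet_derivative f (at (c *\<^sub>R x)) (c *\<^sub>R v))) (at x)"
    by (rule has_derivative_compose[OF _ polynomial_has_derivative[OF f]]) (auto intro!: derivative_eq_intros)
  moreover have "(\<lambda>x. f (c *\<^sub>R x)) = (\<lambda>x. c ^ Suc n * f x)"
    using hom \<open>c \<noteq> 0\<close> by blast
  moreover have "((\<lambda>x. c ^ Suc n * f x) has_derivative (\<lambda>v. c ^ Suc n * frechet_derivative f (at x) v)) (at x)"
    by (intro derivative_intros polynomial_has_derivative f)
  ultimately have "frechet_derivative f (at (c *\<^sub>R x)) (c *\<^sub>R v) = c ^ Suc n * frechet_derivative f (at x) v"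
    using has_derivative_unique by metis
  moreover have "linear (frechet_derivative f (at (c *\<^sub>R x)))"
    using has_derivative_linear polynomial_has_derivative f by blast
  ultimately show ?thesis using \<open>c \<noteq> 0\<close> by (simp add: linear_cmul)
qed

lemma euler_homogeneous:
  fixes f :: "'a::euclidean_space \<Rightarrow> real"
  assumes f: "real_polynomial_function f"
    and hom: "\<And>c x. c \<noteq> 0 \<Longrightarrow> f (c *\<^sub>R x) = c ^ n * f x"
  shows "frechet_derivative f (at x) x = real n * f x"
proof -
  have "((\<lambda>c::real. f (c *\<^sub>R x)) has_derivative (\<lambda>t. frechet_derivative f (at (1 *\<^sub>R x)) (t *\<^sub>R x))) (at 1)"
    by (rule has_derivative_compose[OF _ polynomial_has_derivative[OF f]]) (auto intro!: derivative_eq_intros)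
  then have "((\<lambda>c::real. c ^ n * f x) has_derivative (\<lambda>t. frechet_derivative f (at x) (t *\<^sub>R x))) (at 1)"
    apply simp
    apply (rule has_derivative_transform_within_open[where s="{0<..}" and f="\<lambda>c. f (c *\<^sub>R x)"])
    using hom by auto
  moreover have "((\<lambda>c::real. c ^ n * f x) has_derivative (\<lambda>t. t * (real n * f x))) (at 1)"
    by (auto intro!: derivative_eq_intros)
  ultimately have "(\<lambda>t. frechet_derivative f (at x) (t *\<^sub>R x)) = (\<lambda>t. t * (real n * f x))"
    using has_derivative_unique by blast
  from fun_cong[OF this, of 1] show ?thesis by simp
qed

text \<open>
  Along the line through \<open>0\<close> and \<open>x\<close> such a function is \<open>t \<mapsto> t * f x\<close>, so \<open>f x\<close> is the value at \<open>x\<close>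
  of the derivative of \<open>f\<close> at the origin.
\<close>

lemma homogeneous_degree_one_linear:
  fixes f :: "'a::euclidean_space \<Rightarrow> real"
  assumes f: "real_polynomial_function f"
    and hom: "\<And>c x. c \<noteq> 0 \<Longrightarrow> f (c *\<^sub>R x) = c * f x"
  shows "linear f"
proof -
  have "f x = frechet_derivative f (at 0) x" for x
  proof -
    have f0: "f 0 = 0" using hom[of 2 0] by simp
    have "((\<lambda>c::real. f (c *\<^sub>R x)) has_derivative (\<lambda>t. frechet_derivative f (at (0 *\<^sub>R x)) (t *\<^sub>R x))) (at 0)"
      by (rule has_derivative_compose[OF _ polynomial_has_derivative[OF f]]) (auto intro!: derivative_eq_intros)
    moreover have "(\<lambda>c::real. f (c *\<^sub>R x)) = (\<lambda>c. c * f x)"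
      using hom f0 by (metis (no_types, opaque_lifting) mult_zero_left scaleR_zero_left)
    moreover have "((\<lambda>c::real. c * f x) has_derivative (\<lambda>t. t * f x)) (at 0)"
      by (auto intro!: derivative_eq_intros)
    ultimately have "(\<lambda>t. frechet_derivative f (at (0 *\<^sub>R x)) (t *\<^sub>R x)) = (\<lambda>t. t * f x)"
      using has_derivative_unique by metis
    from fun_cong[OF this, of 1] show ?thesis by simp
  qed
  then have "f = frechet_derivative f (at 0)" by blast
  then show ?thesis
    by (metis has_derivative_linear polynomial_has_derivative f)
qed

text \<open>
  The polarisation of \<open>h\<close>, as a third-order difference. The formula mentions nothing but values of
  \<open>h\<close>, so symmetry and continuity come for free; trilinearity is the property that needs a proof.
\<close>

definition polar :: "('a::euclidean_space \<Rightarrow> real) \<Rightarrow> 'a \<Rightarrow> 'a \<Rightarrow> 'a \<Rightarrow> real" where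
  "polar h x y z =
     (h (x + y + z) - h (x + y) - h (y + z) - h (x + z) + h x + h y + h z) / 6"

lemma polar_commute12: "polar h x y z = polar h y x z"
  by (simp add: polar_def algebra_simps)

lemma polar_commute23: "polar h x y z = polar h x z y"
  by (simp add: polar_def algebra_simps)

text \<open>
  The second derivative \<open>M v u x\<close> of \<open>h\<close> at \<open>x\<close> is linear in \<open>u\<close> and \<open>v\<close> as a derivative, and linear in
  \<open>x\<close> because it is homogeneous of degree one. Euler's identity, used twice, recovers
  \<open>h x = M x x x / 6\<close>, so \<open>polar h\<close> is the symmetrisation of \<open>M / 6\<close>.
\<close>

lemma polar_linear:
  fixes h :: "'a::euclidean_space \<Rightarrow> real"
  assumes "cubic_form h"
  shows "linear (polar h x y)"
proof -
  have h: "real_polynomial_function h" and h3: "\<And>c x. h (c *\<^sub>R x) = c ^ 3 * h x"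
    using assms by (auto simp: cubic_form_def)
  define D where "D x v = frechet_derivative h (at x) v" for x v
  define M where "M v u x = frechet_derivative (\<lambda>x. D x v) (at x) u" for v u x
  have Dp: "real_polynomial_function (\<lambda>x. D x v)" for v
    unfolding D_def by (rule polynomial_frechet_derivative[OF h])
  have D2: "D (c *\<^sub>R x) v = c ^ 2 * D x v" if "c \<noteq> 0" for c x v
    unfolding D_def by (rule frechet_derivative_homogeneous[OF h]) (simp_all add: h3 that eval_nat_numeral)
  have M1: "M v u (c *\<^sub>R x) = c * M v u x" if "c \<noteq> 0" for c x v u
  proof -
    have "frechet_derivative (\<lambda>x. D x v) (at (c *\<^sub>R x)) u = c ^ 1 * frechet_derivative (\<lambda>x. D x v) (at x) u"
      by (rule frechet_derivative_homogeneous[OF Dp]) (simp_all add: D2 that power2_eq_square)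
    then show ?thesis by (simp add: M_def)
  qed
  have "linear (M v u)" for v u
    unfolding M_def
    by (rule homogeneous_degree_one_linear)
      (use M1 polynomial_frechet_derivative[OF Dp] in \<open>simp_all add: M_def\<close>)
  then have M_x: "M v u (a + b) = M v u a + M v u b" "M v u (c *\<^sub>R a) = c * M v u a" for v u a b c
    by (simp_all add: linear_add linear_cmul)
  have "linear (\<lambda>u. M v u x)" for v x
    unfolding M_def using has_derivative_linear polynomial_has_derivative[OF Dp] by blast
  then have M_u: "M v (a + b) x = M v a x + M v b x" "M v (c *\<^sub>R a) x = c * M v a x" for v x a b c
    using linear_add[of "\<lambda>u. M v u x" a b] linear_cmul[of "\<lambda>u. M v u x" c a] by simp_all
  have "linear (D x)" for x
    unfolding D_def by (metis has_derivative_linear polynomial_has_derivative h)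
  then have D_v: "D x (c *\<^sub>R a + b) = c * D x a + D x b" for x a b c
    by (simp add: linear_add linear_cmul)
  have M_v': "M (c *\<^sub>R a + b) u x = c * M a u x + M b u x" for u x a b c
  proof -
    have "((\<lambda>x. c * D x a + D x b) has_derivative (\<lambda>u. c * M a u x + M b u x)) (at x)"
      unfolding M_def by (intro has_derivative_add has_derivative_mult_right polynomial_has_derivative Dp)
    then have "((\<lambda>x. D x (c *\<^sub>R a + b)) has_derivative (\<lambda>u. c * M a u x + M b u x)) (at x)"
      by (simp add: D_v)
    then have "frechet_derivative (\<lambda>x. D x (c *\<^sub>R a + b)) (at x) = (\<lambda>u. c * M a u x + M b u x)"
      by (metis frechet_derivative_at)
    then show ?thesis unfolding M_def by simp
  qed
  have M_v: "M (a + b) u x = M a u x + M b u x" "M (c *\<^sub>R a) u x = c * M a u x" for u x a b c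
    using M_v'[where c=1 and a=a and b=b] M_v'[where c=1 and a=0 and b=0] M_v'[where c=c and a=a and b=0] by simp_all
  have hM: "h x = M x x x / 6" for x
  proof -
    have "D x x = 3 * h x" unfolding D_def using euler_homogeneous[OF h, where n=3] h3 by simp
    moreover have "M x x x = 2 * D x x"
      unfolding M_def using euler_homogeneous[OF Dp, where n=2] D2 by simp
    ultimately show ?thesis by simp
  qed
  have eq: "polar h x y z = (M x y z + M x z y + M y x z + M y z x + M z x y + M z y x) / 36" for x y z
    unfolding polar_def hM M_x M_u M_v by argo
  have "polar h x y (a + b) = polar h x y a + polar h x y b" for a b
    unfolding eq M_x M_u M_v by argo
  moreover have "polar h x y (c *\<^sub>R a) = c * polar h x y a" for a c
    unfolding eq M_x M_u M_v by (simp add: distrib_left)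
  ultimately show ?thesis
    by (simp add: linear_iff)
qed

lemma polar_linear_slots:
  assumes "cubic_form h"
  shows "linear (\<lambda>x. polar h x y z)" "linear (\<lambda>x. polar h y x z)" "linear (\<lambda>x. polar h y z x)"
proof -
  have "polar h y x z = polar h y z x" "polar h x y z = polar h y z x" for x
    by (rule polar_commute23, rule trans[OF polar_commute12 polar_commute23])
  then have "(\<lambda>x. polar h y x z) = polar h y z" "(\<lambda>x. polar h x y z) = polar h y z"
    by blast+
  with polar_linear[OF assms, of y z]
  show "linear (\<lambda>x. polar h x y z)" "linear (\<lambda>x. polar h y x z)" "linear (\<lambda>x. polar h y z x)"
    by simp_all
qed

lemma polar_add:
  assumes "cubic_form h"
  shows "polar h (a + b) y z = polar h a y z + polar h b y z"
    and "polar h x (a + b) z = polar h x a z + polar h x b z"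
    and "polar h x y (a + b) = polar h x y a + polar h x y b"
  using polar_linear_slots[OF assms, THEN linear_add] by simp_all

lemma polar_scaleR:
  assumes "cubic_form h"
  shows "polar h (c *\<^sub>R a) y z = c * polar h a y z"
    and "polar h x (c *\<^sub>R a) z = c * polar h x a z"
    and "polar h x y (c *\<^sub>R a) = c * polar h x y a"
  using polar_linear_slots[OF assms, THEN linear_cmul] by simp_all

lemma polar_diff:
  assumes "cubic_form h"
  shows "polar h (a - b) y z = polar h a y z - polar h b y z"
    and "polar h x (a - b) z = polar h x a z - polar h x b z"
    and "polar h x y (a - b) = polar h x y a - polar h x y b"
  using polar_linear_slots[OF assms, THEN linear_diff] by simp_all

lemma polar_zero:
  assumes "cubic_form h"
  shows "polar h 0 y z = 0" "polar h x 0 z = 0" "polar h x y 0 = 0"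
  using polar_scaleR[OF assms, where c=0 and a=0] by simp_all

lemma polar_diag:
  assumes "cubic_form h"
  shows "polar h x x x = h x"
proof -
  have "x + x = 2 *\<^sub>R x" "x + x + x = 3 *\<^sub>R x"
    using scaleR_left_distrib[of 1 2 x] by (simp_all add: scaleR_2)
  then have "h (x + x + x) = 27 * h x" "h (x + x) = 8 * h x"
    using assms unfolding cubic_form_def by simp_all
  then show ?thesis by (simp add: polar_def)
qed

lemma cubic_add:
  assumes h: "cubic_form h"
  shows "h (x + y) = h x + 3 * polar h x x y + 3 * polar h x y y + h y"
proof -
  have "h (x + y) = polar h (x + y) (x + y) (x + y)"
    by (simp add: polar_diag[OF h])
  also have "\<dots> = polar h x x x + (polar h x x y + polar h x y x + polar h y x x)
      + (polar h x y y + polar h y x y + polar h y y x) + polar h y y y"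
    by (simp add: polar_add[OF h])
  also have "polar h x y x = polar h x x y" by (rule polar_commute23)
  also have "polar h y x x = polar h x x y" by (rule trans[OF polar_commute12 polar_commute23])
  also have "polar h y x y = polar h x y y" by (rule polar_commute12)
  also have "polar h y y x = polar h x y y" by (rule trans[OF polar_commute23 polar_commute12])
  finally show ?thesis by (simp add: polar_diag[OF h])
qed

lemma cubic_difference:
  assumes h: "cubic_form h"
  shows "h y - h x = polar h y y (y - x) + polar h y x (y - x) + polar h x x (y - x)"
proof -
  have "polar h y x y = polar h y y x" by (rule polar_commute23)
  moreover have "polar h x x y = polar h y x x" by (rule trans[OF polar_commute23 polar_commute12])
  ultimately show ?thesis by (simp add: polar_diff[OF h] polar_diag[OF h])
qed

lemma continuous_on_polar [continuous_intros]:
  assumes h: "cubic_form h" and "continuous_on S a" "continuous_on S b" "continuous_on S c"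
  shows "continuous_on S (\<lambda>x. polar h (a x) (b x) (c x))"
proof -
  have *: "continuous_on S (\<lambda>x. h (f x))" if "continuous_on S f" for f
    using continuous_on_compose2[OF polynomial_continuous_on[of h UNIV] that] h
    by (auto simp: cubic_form_def)
  show ?thesis unfolding polar_def
    by (intro continuous_intros * assms) auto
qed

text \<open>
  Derivatives of a polynomial can be read off from its restriction to lines, where a cubic is an
  explicit polynomial of one variable.
\<close>

lemma frechet_derivative_along_line:
  fixes f :: "'a::euclidean_space \<Rightarrow> real"
  assumes "real_polynomial_function f"
    and "((\<lambda>t. f (x + t *\<^sub>R v)) has_real_derivative d) (at 0)"
  shows "frechet_derivative f (at x) v = d"
proof -
  have "((\<lambda>t::real. f (x + t *\<^sub>R v)) has_derivative (\<lambda>t. frechet_derivative f (at (x + 0 *\<^sub>R v)) (t *\<^sub>R v))) (at 0)"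
    by (rule has_derivative_compose[OF _ polynomial_has_derivative[OF assms(1)]]) (auto intro!: derivative_eq_intros)
  moreover have "((\<lambda>t. f (x + t *\<^sub>R v)) has_derivative (\<lambda>t. d * t)) (at 0)"
    using assms(2) by (simp add: has_field_derivative_def)
  ultimately have "(\<lambda>t. frechet_derivative f (at (x + 0 *\<^sub>R v)) (t *\<^sub>R v)) = (\<lambda>t. d * t)"
    by (rule has_derivative_unique)
  from fun_cong[OF this, of 1] show ?thesis by simp
qed

lemma frechet_derivative_cubic:
  assumes h: "cubic_form h"
  shows "frechet_derivative h (at x) v = 3 * polar h x x v"
proof (rule frechet_derivative_along_line)
  show "real_polynomial_function h" using h by (simp add: cubic_form_def)
  have "h (x + t *\<^sub>R v) = h x + 3 * t * polar h x x v + 3 * t^2 * polar h x v v + t^3 * h v" (is "_ = ?g t") for t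
    by (simp add: cubic_add[OF h] polar_scaleR[OF h] power2_eq_square)
      (use h in \<open>simp add: cubic_form_def\<close>)
  then have "(\<lambda>t. h (x + t *\<^sub>R v)) = ?g" by blast
  moreover have "(?g has_real_derivative 3 * polar h x x v) (at 0)"
    by (auto intro!: derivative_eq_intros)
  ultimately show "((\<lambda>t. h (x + t *\<^sub>R v)) has_real_derivative 3 * polar h x x v) (at 0)"
    by (simp only:)
qed

lemma hessian_cubic:
  assumes h: "cubic_form h"
  shows "hessian h p u v = 6 * polar h p u v"
  unfolding hessian_def
proof (rule frechet_derivative_along_line)
  show "real_polynomial_function (\<lambda>x. frechet_derivative h (at x) v)"
    using h by (simp add: cubic_form_def polynomial_frechet_derivative)
  have "frechet_derivative h (at (p + t *\<^sub>R u)) v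
     = 3 * polar h p p v + 6 * t * polar h p u v + 3 * t^2 * polar h u u v" (is "_ = ?g t") for t
  proof -
    have "polar h (p + t *\<^sub>R u) (p + t *\<^sub>R u) v
        = polar h p p v + t * polar h p u v + t * polar h u p v + t * (t * polar h u u v)"
      by (simp add: polar_scaleR[OF h] polar_add[OF h] distrib_left)
    also have "polar h u p v = polar h p u v" by (rule polar_commute12)
    finally show ?thesis
      by (simp add: frechet_derivative_cubic[OF h] power2_eq_square)
  qed
  then have "(\<lambda>t. frechet_derivative h (at (p + t *\<^sub>R u)) v) = ?g" by blast
  moreover have "(?g has_real_derivative 6 * polar h p u v) (at 0)"
    by (auto intro!: derivative_eq_intros)
  ultimately show "((\<lambda>t. frechet_derivative h (at (p + t *\<^sub>R u)) v) has_real_derivative 6 * polar h p u v) (at 0)"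
    by (simp only:)
qed

section \<open>Lorentz signature without eigenvalues\<close>

text \<open>
  The spectral theorem, relative to a subspace: a maximiser \<open>e\<close> of the quadratic form on the unit
  sphere of \<open>S\<close> is an eigenvector, because a nonzero \<open>B e v\<close> with \<open>v\<close> orthogonal to \<open>e\<close> would let the
  quadratic form grow from \<open>e\<close> in direction \<open>v\<close>. Then \<open>S\<close> is replaced by the complement of \<open>e\<close> in it.
\<close>

lemma symmetric_bilinear_eigenbasis:
  fixes B :: "'a::euclidean_space \<Rightarrow> 'a \<Rightarrow> real"
  assumes sym: "\<And>u v. B u v = B v u" and lin: "\<And>u. linear (B u)" and "subspace S"
  shows "\<exists>E \<mu>. E \<subseteq> S \<and> pairwise orthogonal E \<and> (\<forall>e\<in>E. norm e = 1) \<and> span E = S \<and>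
           (\<forall>e\<in>E. \<forall>v\<in>S. B e v = \<mu> e * (e \<bullet> v))"
  using \<open>subspace S\<close>
proof (induction "dim S" arbitrary: S rule: less_induct)
  case less
  note add = linear_add[OF lin] and scale = linear_cmul[OF lin]
  have add': "B (a + b) v = B a v + B b v" and scale': "B (c *\<^sub>R a) v = c * B a v" for a b v c
    using add[of v a b] scale[of v c a] by (simp_all add: sym[of _ v])
  show ?case
  proof (cases "S = {0}")
    case True
    then show ?thesis by (intro exI[of _ "{}"]) auto
  next
    case False
    then obtain w where w: "w \<in> S" "w \<noteq> 0"
      using subspace_0[OF less.prems] by blast
    have "bilinear B"
      unfolding bilinear_def using lin add' scale' by (auto simp: linear_iff)
    then have cont: "continuous_on X (\<lambda>v. B v v)" for X
      by (intro bounded_bilinear.continuous_on[of B] continuous_on_id)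
         (simp add: bilinear_conv_bounded_bilinear)
    have "compact (sphere 0 1 \<inter> S)"
      using less.prems by (simp add: closed_subspace compact_Int_closed)
    moreover have "w /\<^sub>R norm w \<in> sphere 0 1 \<inter> S"
      using w less.prems by (simp add: subspace_scale)
    ultimately obtain e where e: "e \<in> S" "norm e = 1"
      and emax: "\<And>v. v \<in> S \<Longrightarrow> norm v = 1 \<Longrightarrow> B v v \<le> B e e"
      using continuous_attains_sup[OF _ _ cont, of "sphere 0 1 \<inter> S"] by fastforce
    have ee: "e \<bullet> e = 1" using e by (simp add: norm_eq_1)
    have max: "B v v \<le> B e e * (v \<bullet> v)" if "v \<in> S" for v
    proof (cases "v = 0")
      case True then show ?thesis using scale[of 0 0 0] by simp
    next
      case False
      have "B (v /\<^sub>R norm v) (v /\<^sub>R norm v) \<le> B e e"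
        using that less.prems False by (intro emax) (auto simp: subspace_scale)
      then have "B v v / (norm v)^2 \<le> B e e"
        by (simp add: scale scale' power2_eq_square field_simps)
      then show ?thesis using False by (simp add: dot_square_norm field_simps)
    qed
    have perp: "B e v = 0" if v: "v \<in> S" "v \<bullet> e = 0" for v
    proof (rule ccontr)
      assume b: "B e v \<noteq> 0"
      define c where "c = B e e * (v \<bullet> v) - B v v"
      have "c \<ge> 0" using max[OF v(1)] by (simp add: c_def)
      define t where "t = B e v / (c + 1)"
      have "B (e + t *\<^sub>R v) (e + t *\<^sub>R v) \<le> B e e * ((e + t *\<^sub>R v) \<bullet> (e + t *\<^sub>R v))"
        using v e less.prems by (intro max) (auto simp: subspace_add subspace_scale)
      moreover have "(e + t *\<^sub>R v) \<bullet> (e + t *\<^sub>R v) = 1 + t^2 * (v \<bullet> v)"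
        using ee v(2) by (simp add: inner_add_left inner_add_right inner_commute power2_eq_square)
      moreover have "B (e + t *\<^sub>R v) (e + t *\<^sub>R v) = B e e + 2 * t * B e v + t^2 * B v v"
        using sym[of v e] by (simp add: add add' scale scale' power2_eq_square algebra_simps)
      ultimately have "B e e + 2 * t * B e v + t^2 * B v v \<le> B e e * (1 + t^2 * (v \<bullet> v))"
        by (simp only:)
      then have "2 * t * B e v \<le> t^2 * c"
        by (simp add: c_def algebra_simps)
      moreover have "B e v = t * (c + 1)" using \<open>c \<ge> 0\<close> by (simp add: t_def)
      ultimately have "t^2 * (c + 2) \<le> 0" by (simp add: algebra_simps power2_eq_square)
      moreover have "t^2 * (c + 2) > 0" using b \<open>c \<ge> 0\<close> by (intro mult_pos_pos) (auto simp: t_def)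
      ultimately show False by simp
    qed
    define S' where "S' = {v \<in> S. v \<bullet> e = 0}"
    have S': "subspace S'"
      unfolding S'_def using less.prems by (auto simp: subspace_def inner_add_left)
    have "e \<notin> S'" using ee by (simp add: S'_def)
    moreover have "S' \<subseteq> S" by (auto simp: S'_def)
    ultimately have "S' \<subset> S" using e(1) by blast
    then have "dim S' < dim S"
      using less.prems S' by (metis dim_psubset span_eq_iff)
    from less.hyps[OF this S'] obtain E \<mu> where E: "E \<subseteq> S'" "pairwise orthogonal E"
      "\<forall>e\<in>E. norm e = 1" "span E = S'" "\<forall>e\<in>E. \<forall>v\<in>S'. B e v = \<mu> e * (e \<bullet> v)" by blast
    have proj: "v - (v \<bullet> e) *\<^sub>R e \<in> S'" if "v \<in> S" for v
      using that e ee less.prems by (auto simp: S'_def subspace_diff subspace_scale inner_diff_left)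
    have dec: "B u v = (v \<bullet> e) * B u e + B u (v - (v \<bullet> e) *\<^sub>R e)" for u v
      using add[of u "(v \<bullet> e) *\<^sub>R e" "v - (v \<bullet> e) *\<^sub>R e"] scale[of u "v \<bullet> e" e] by simp
    have orth: "e' \<bullet> e = 0" if "e' \<in> E" for e' using E that by (auto simp: S'_def)
    have "e \<notin> E" using E(1) ee by (auto simp: S'_def)
    show ?thesis
    proof (intro exI conjI ballI)
      show "insert e E \<subseteq> S" using E(1) e by (auto simp: S'_def)
      show "pairwise orthogonal (insert e E)"
        using E(2) orth by (auto simp: pairwise_insert orthogonal_def inner_commute)
      show "norm x = 1" if "x \<in> insert e E" for x using that e E by auto
      show "span (insert e E) = S"
      proof
        show "span (insert e E) \<subseteq> S"
          using \<open>insert e E \<subseteq> S\<close> less.prems by (simp add: span_minimal)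
        show "S \<subseteq> span (insert e E)"
          unfolding span_insert E(4) using proj by auto
      qed
      show "B x v = (\<mu>(e := B e e)) x * (x \<bullet> v)" if "x \<in> insert e E" "v \<in> S" for x v
      proof (cases "x = e")
        case True
        have "B e (v - (v \<bullet> e) *\<^sub>R e) = 0"
          using proj[OF that(2)] perp by (auto simp: S'_def)
        then show ?thesis using True dec[of e v] by (simp add: inner_commute)
      next
        case False
        then have "x \<in> E" using that by simp
        then have "B x e = 0" using perp[of x] E(1) sym[of x e] orth by (auto simp: S'_def)
        moreover have "B x (v - (v \<bullet> e) *\<^sub>R e) = \<mu> x * (x \<bullet> v)"
          using E(5) \<open>x \<in> E\<close> proj[OF that(2)] orth by (simp add: inner_diff_right)
        ultimately show ?thesis using False dec[of x v] by simp
      qed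
    qed
  qed
qed

lemma bilinear_eigenbasis_expand:
  fixes B :: "'a::euclidean_space \<Rightarrow> 'a \<Rightarrow> real"
  assumes sym: "\<And>u v. B u v = B v u" and lin: "\<And>u. linear (B u)"
    and E: "pairwise orthogonal E" "\<forall>e\<in>E. norm e = 1" "span E = UNIV"
    and eig: "\<forall>e\<in>E. \<forall>v. B e v = \<mu> e * (e \<bullet> v)"
  shows "finite E" "card E = DIM('a)" "B v v = (\<Sum>e\<in>E. \<mu> e * (e \<bullet> v)^2)"
proof -
  have "0 \<notin> E" using E(2) by force
  then have ind: "independent E" using E(1) pairwise_orthogonal_independent by blast
  then show fin: "finite E" using independent_bound by blast
  show "card E = DIM('a)"
    using ind E(3) by (metis dim_UNIV dim_span_eq_card_independent)
  have "(\<Sum>e\<in>E. (v \<bullet> e) *\<^sub>R e) = v"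
    using E fin by (intro orthonormal_basis_expand) auto
  then have "B v v = B v (\<Sum>e\<in>E. (v \<bullet> e) *\<^sub>R e)" by simp
  also have "\<dots> = (\<Sum>e\<in>E. (v \<bullet> e) * B e v)"
    by (simp add: linear_sum[OF lin] linear_cmul[OF lin] sym[of v])
  also have "\<dots> = (\<Sum>e\<in>E. \<mu> e * (e \<bullet> v)^2)"
    using eig by (intro sum.cong) (auto simp: power2_eq_square inner_commute)
  finally show "B v v = (\<Sum>e\<in>E. \<mu> e * (e \<bullet> v)^2)" .
qed

text \<open>
  This characterisation refers to no inner product, so it is stable under linear changes of
  coordinates, which the eigenvalues are not. From left to right, \<open>q\<close> is the negative eigenvector.
  Conversely, two eigenvectors with nonpositive eigenvalues would span a plane on which \<open>B\<close> is
  nonpositive, and this plane contains a nonzero vector of the \<open>B\<close>-complement of \<open>q\<close>.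
\<close>

lemma lorentz_signature_iff:
  fixes B :: "'a::euclidean_space \<Rightarrow> 'a \<Rightarrow> real"
  assumes sym: "\<And>u v. B u v = B v u" and lin: "\<And>u. linear (B u)"
  shows "lorentz_signature B \<longleftrightarrow> (\<exists>q. B q q < 0 \<and> (\<forall>v. B q v = 0 \<and> v \<noteq> 0 \<longrightarrow> B v v > 0))"
    (is "_ \<longleftrightarrow> ?rhs")
proof
  assume "lorentz_signature B"
  then obtain E \<mu> where E: "pairwise orthogonal E" "\<forall>e\<in>E. norm e = 1" "span E = UNIV"
    and eig: "\<forall>e\<in>E. \<forall>v. B e v = \<mu> e * (e \<bullet> v)"
    and pos: "card {e \<in> E. \<mu> e > 0} = DIM('a) - 1" and neg: "card {e \<in> E. \<mu> e < 0} = 1"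
    unfolding lorentz_signature_def by blast
  note exp = bilinear_eigenbasis_expand[OF sym lin E eig]
  obtain q where q: "{e \<in> E. \<mu> e < 0} = {q}" using neg card_1_singletonE by blast
  have "card ({e \<in> E. \<mu> e > 0} \<union> {e \<in> E. \<mu> e < 0}) = DIM('a)"
    using exp(1) pos neg DIM_positive[where 'a='a] by (subst card_Un_disjoint) auto
  then have "{e \<in> E. \<mu> e > 0} \<union> {e \<in> E. \<mu> e < 0} = E"
    using exp(1,2) by (intro card_subset_eq) auto
  then have pos': "\<mu> e > 0" if "e \<in> E" "e \<noteq> q" for e using that q by blast
  have qE: "q \<in> E" "\<mu> q < 0" using q by blast+
  have "q \<bullet> q = 1" using E(2) qE by (simp add: norm_eq_1)
  show ?rhs
  proof (intro exI conjI allI impI)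
    show "B q q < 0" using eig qE \<open>q \<bullet> q = 1\<close> by simp
    fix v assume v: "B q v = 0 \<and> v \<noteq> 0"
    then have qv: "q \<bullet> v = 0" using eig qE by auto
    have "\<exists>e\<in>E. e \<bullet> v \<noteq> 0"
    proof (rule ccontr)
      assume "\<not> ?thesis"
      then have "orthogonal v e" if "e \<in> E" for e using that by (simp add: orthogonal_def inner_commute)
      then have "orthogonal v v" using E(3) orthogonal_to_span[of v E v] by simp
      then show False using v by (simp add: orthogonal_self)
    qed
    then obtain e where e: "e \<in> E" "e \<bullet> v \<noteq> 0" by blast
    have "(\<Sum>e\<in>E. \<mu> e * (e \<bullet> v)^2) > 0"
    proof (rule sum_pos2[OF exp(1) e(1)])
      show "0 < \<mu> e * (e \<bullet> v)\<^sup>2" using e pos'[of e] qv by (intro mult_pos_pos) auto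
      show "0 \<le> \<mu> i * (i \<bullet> v)\<^sup>2" if "i \<in> E" for i
        using that pos'[of i] qv by (cases "i = q") auto
    qed
    then show "B v v > 0" using exp(3) by simp
  qed
next
  assume ?rhs
  then obtain q where q: "B q q < 0" and qperp: "\<And>v. B q v = 0 \<Longrightarrow> v \<noteq> 0 \<Longrightarrow> B v v > 0" by blast
  obtain E \<mu> where E: "pairwise orthogonal E" "\<forall>e\<in>E. norm e = 1" "span E = UNIV"
    and eig: "\<forall>e\<in>E. \<forall>v. B e v = \<mu> e * (e \<bullet> v)"
    using symmetric_bilinear_eigenbasis[OF sym lin subspace_UNIV] by auto
  note exp = bilinear_eigenbasis_expand[OF sym lin E eig]
  have one: "e \<bullet> e = 1" if "e \<in> E" for e using E(2) that by (simp add: norm_eq_1)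
  have orth: "e \<bullet> e' = 0" if "e \<in> E" "e' \<in> E" "e \<noteq> e'" for e e'
    using E(1) that by (auto simp: pairwise_def orthogonal_def)
  have uniq: "e1 = e2" if e: "e1 \<in> E" "e2 \<in> E" and m: "\<mu> e1 \<le> 0" "\<mu> e2 \<le> 0" for e1 e2
  proof (rule ccontr)
    assume ne: "e1 \<noteq> e2"
    have "e1 \<noteq> 0" using one[OF e(1)] by auto
    have B1: "B e1 v = \<mu> e1 * (e1 \<bullet> v)" and B2: "B e2 v = \<mu> e2 * (e2 \<bullet> v)" for v using eig e by auto
    show False
    proof (cases "B q e1 = 0")
      case True
      then show False using qperp[of e1] \<open>e1 \<noteq> 0\<close> B1[of e1] one[OF e(1)] m by simp
    next
      case False
      define v where "v = B q e2 *\<^sub>R e1 - B q e1 *\<^sub>R e2"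
      have "B q v = 0" by (simp add: v_def linear_diff[OF lin] linear_cmul[OF lin])
      moreover have "v \<bullet> e2 = - B q e1"
        using orth[OF e ne] one[OF e(2)] by (simp add: v_def inner_diff_left)
      then have "v \<noteq> 0" using False by auto
      moreover have "B v v = (B q e2)^2 * \<mu> e1 + (B q e1)^2 * \<mu> e2"
      proof -
        have "B v v = B q e2 * B e1 v - B q e1 * B e2 v"
          using linear_diff[OF lin, of v] linear_cmul[OF lin, of v] sym[of v]
          by (metis v_def real_scaleR_def)
        also have "e1 \<bullet> v = B q e2" "e2 \<bullet> v = - B q e1"
          using orth[OF e ne] one e by (simp_all add: v_def inner_diff_right inner_commute)
        then have "B q e2 * B e1 v - B q e1 * B e2 v = (B q e2)^2 * \<mu> e1 + (B q e1)^2 * \<mu> e2"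
          unfolding B1 B2 by (simp add: power2_eq_square)
        finally show ?thesis .
      qed
      moreover have "(B q e2)^2 * \<mu> e1 \<le> 0" "(B q e1)^2 * \<mu> e2 \<le> 0"
        using m by (simp_all add: mult_nonneg_nonpos)
      ultimately show False using qperp[of v] by linarith
    qed
  qed
  have "\<exists>e\<in>E. \<mu> e < 0"
  proof (rule ccontr)
    assume "\<not> ?thesis"
    then have "(\<Sum>e\<in>E. \<mu> e * (e \<bullet> q)^2) \<ge> 0" by (intro sum_nonneg) (auto simp: not_less)
    then show False using exp(3)[of q] q by simp
  qed
  then obtain e0 where e0: "e0 \<in> E" "\<mu> e0 < 0" by blast
  have neg: "{e \<in> E. \<mu> e < 0} = {e0}" using uniq e0 by (auto intro: less_imp_le)
  have "\<mu> e > 0 \<longleftrightarrow> e \<noteq> e0" if "e \<in> E" for e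
    using uniq[of e e0] that e0 by (cases "\<mu> e \<le> 0") auto
  then have "{e \<in> E. \<mu> e > 0} = E - {e0}" by blast
  then have "card {e \<in> E. \<mu> e > 0} = DIM('a) - 1" using exp(1,2) e0 by simp
  then show "lorentz_signature B"
    unfolding lorentz_signature_def using E eig neg by (intro exI[of _ E] exI[of _ \<mu>]) auto
qed

lemma hyperbolic_point_iff:
  assumes h: "cubic_form h"
  shows "hyperbolic_point h p \<longleftrightarrow> h p > 0 \<and>
    (\<exists>q. polar h p q q > 0 \<and> (\<forall>v. polar h p q v = 0 \<and> v \<noteq> 0 \<longrightarrow> polar h p v v < 0))"
proof -
  have "lorentz_signature (\<lambda>u v. - hessian h p u v) \<longleftrightarrow>
    (\<exists>q. - hessian h p q q < 0 \<and> (\<forall>v. - hessian h p q v = 0 \<and> v \<noteq> 0 \<longrightarrow> - hessian h p v v > 0))"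
  proof (rule lorentz_signature_iff)
    show "- hessian h p u v = - hessian h p v u" for u v
      unfolding hessian_cubic[OF h] by (simp add: polar_commute23[of h p u v])
    show "linear (\<lambda>v. - hessian h p u v)" for u
      unfolding hessian_cubic[OF h] linear_iff by (simp add: polar_add[OF h] polar_scaleR[OF h])
  qed
  then show ?thesis by (simp add: hyperbolic_point_def hessian_cubic[OF h])
qed

section \<open>The cone over a CCPSR manifold\<close>

lemma pos_along_direction:
  fixes F :: "'a::euclidean_space \<Rightarrow> real"
  assumes "(F has_derivative F') (at p)" "F p = 0" "F' w > 0"
  shows "eventually (\<lambda>t. F (p + t *\<^sub>R w) > 0) (at_right 0)"
proof -
  have "((\<lambda>t::real. F (p + t *\<^sub>R w)) has_derivative (\<lambda>t. F' (t *\<^sub>R w))) (at 0)"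
    by (rule has_derivative_compose[where f="\<lambda>t. p + t *\<^sub>R w" and g=F])
      (use assms in \<open>auto intro!: derivative_eq_intros\<close>)
  moreover have "F' (t *\<^sub>R w) = F' w * t" for t
    using linear_cmul[OF has_derivative_linear[OF assms(1)]] by simp
  ultimately have "((\<lambda>t::real. F (p + t *\<^sub>R w)) has_real_derivative F' w) (at 0)"
    by (simp add: has_field_derivative_def)
  from DERIV_pos_inc_right[OF this assms(3)] obtain d where "d > 0" "\<forall>t>0. t < d \<longrightarrow> F (p + t *\<^sub>R w) > 0"
    using assms(2) by auto
  then show ?thesis unfolding eventually_at_right_field by blast
qed

lemma eventually_at_right_0_less: "c > 0 \<Longrightarrow> eventually (\<lambda>t::real. t < c) (at_right 0)"
  by (auto simp: eventually_at_right_field)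

text \<open>
  The hypersurface \<open>H\<close> has a local equation \<open>F\<close> of its own; only the inclusion of \<open>H\<close> in the level set
  of \<open>h\<close> relates \<open>F\<close> to \<open>h\<close>. If \<open>F' p\<close> were \<open>0\<close>, then, as \<open>F' e > 0\<close> for some \<open>e\<close>, there would be points of
  \<open>H\<close> of the form \<open>p + t (p + \<sigma> e)\<close> with \<open>t\<close> and \<open>\<sigma>\<close> small. But \<open>h\<close> grows at rate about \<open>3\<close> in these
  directions, while it equals \<open>1\<close> on \<open>H\<close>.
\<close>

lemma hypersurface_transversal:
  fixes h F F' :: "'a::euclidean_space \<Rightarrow> real"
  assumes h: "cubic_form h" and "p \<in> H" "H \<subseteq> {x. h x = 1}"
    and U: "open U" "p \<in> U" "continuous_on U F" "H \<inter> U = {x \<in> U. F x = 0}"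
    and F': "(F has_derivative F') (at p)" "F' \<noteq> (\<lambda>v. 0)"
  shows "F' p \<noteq> 0"
proof
  assume p0: "F' p = 0"
  have lin: "linear F'" using has_derivative_linear F'(1) .
  obtain e0 where "F' e0 \<noteq> 0" using F'(2) by blast
  define e where "e = F' e0 *\<^sub>R e0"
  have Fe: "F' e > 0" using \<open>F' e0 \<noteq> 0\<close> by (simp add: e_def linear_cmul[OF lin] not_sum_power2_lt_zero flip: power2_eq_square)
  have hp: "h p = 1" "F p = 0" using assms by auto
  \<comment> \<open>With this bound on \<open>\<sigma>\<close> the slope \<open>polar h p p (p + \<sigma> e)\<close> is at least \<open>1/2\<close>.\<close>
  define \<epsilon> where "\<epsilon> = 1 / (2 * (\<bar>polar h p p e\<bar> + 1))"
  have \<epsilon>: "\<epsilon> > 0" "\<epsilon> * \<bar>polar h p p e\<bar> \<le> 1/2"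
    by (simp_all add: \<epsilon>_def field_simps)
  define C where "C = norm p + \<epsilon> * norm e + 1"
  have C: "C > 0" using \<epsilon>(1) by (simp add: C_def add_nonneg_pos)
  have "(h has_derivative (\<lambda>v. 3 * polar h p p v)) (at p)"
    using polynomial_has_derivative[of h p] h frechet_derivative_cubic[OF h, of p]
    by (metis (no_types, lifting) cubic_form_def ext)
  then obtain d where d: "d > 0" "\<And>y. norm (y - p) < d \<Longrightarrow>
      norm (h y - h p - 3 * polar h p p (y - p)) \<le> (1 / C) * norm (y - p)"
    unfolding has_derivative_at_alt using C by (metis divide_pos_pos zero_less_one)
  obtain \<rho> where \<rho>: "\<rho> > 0" "ball p \<rho> \<subseteq> U" using U by (meson open_contains_ball)
  have e1: "eventually (\<lambda>t. F (p + t *\<^sub>R (p + \<epsilon> *\<^sub>R e)) > 0) (at_right 0)"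
    by (rule pos_along_direction[OF F'(1) hp(2)]) (use Fe \<epsilon> p0 in \<open>simp add: linear_add[OF lin] linear_cmul[OF lin]\<close>)
  have "((\<lambda>x. - F x) has_derivative (\<lambda>v. - F' v)) (at p)"
    by (intro derivative_intros F')
  then have e2: "eventually (\<lambda>t. - F (p + t *\<^sub>R (p - \<epsilon> *\<^sub>R e)) > 0) (at_right 0)"
    by (rule pos_along_direction) (use Fe \<epsilon> p0 hp in \<open>auto simp: linear_diff[OF lin] linear_cmul[OF lin]\<close>)
  have e3: "eventually (\<lambda>t. t < min d \<rho> / C) (at_right 0)"
    using C d \<rho> by (intro eventually_at_right_0_less) auto
  obtain t where t: "t > 0" "F (p + t *\<^sub>R (p + \<epsilon> *\<^sub>R e)) > 0" "F (p + t *\<^sub>R (p - \<epsilon> *\<^sub>R e)) < 0" "t < min d \<rho> / C"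
    using eventually_happens'[OF _ eventually_conj[OF eventually_conj[OF e1 e2] eventually_conj[OF e3 eventually_at_right_less]]]
    by auto
  have tC: "t * C < d" "t * C < \<rho>" using t(4) C by (auto simp: field_simps)
  have bound: "norm (p + \<sigma> *\<^sub>R e) < C" if "\<bar>\<sigma>\<bar> \<le> \<epsilon>" for \<sigma>
  proof -
    have "norm (p + \<sigma> *\<^sub>R e) \<le> norm p + \<bar>\<sigma>\<bar> * norm e"
      by (metis norm_scaleR norm_triangle_ineq)
    also have "\<bar>\<sigma>\<bar> * norm e \<le> \<epsilon> * norm e" using that by (simp add: mult_right_mono)
    finally show ?thesis by (simp add: C_def)
  qed
  have small: "norm (t *\<^sub>R (p + \<sigma> *\<^sub>R e)) < t * C" if "\<bar>\<sigma>\<bar> \<le> \<epsilon>" for \<sigma>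
    using bound[OF that] t(1) by simp
  have inU: "p + t *\<^sub>R (p + \<sigma> *\<^sub>R e) \<in> U" if "\<bar>\<sigma>\<bar> \<le> \<epsilon>" for \<sigma>
    using small[OF that] tC \<rho> by (auto simp: dist_norm intro!: subsetD[OF \<rho>(2)])
  have "continuous_on {-\<epsilon>..\<epsilon>} (\<lambda>\<sigma>. F (p + t *\<^sub>R (p + \<sigma> *\<^sub>R e)))"
    using inU by (intro continuous_on_compose2[OF U(3)] continuous_intros) (auto simp: abs_le_iff)
  then have "\<exists>\<sigma>\<ge>-\<epsilon>. \<sigma> \<le> \<epsilon> \<and> F (p + t *\<^sub>R (p + \<sigma> *\<^sub>R e)) = 0"
    using t \<epsilon> by (intro IVT') auto
  then obtain \<sigma> where \<sigma>: "\<bar>\<sigma>\<bar> \<le> \<epsilon>" "F (p + t *\<^sub>R (p + \<sigma> *\<^sub>R e)) = 0"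
    by (metis abs_le_iff minus_le_iff)
  then have "p + t *\<^sub>R (p + \<sigma> *\<^sub>R e) \<in> H" using inU U(4) by blast
  then have h1: "h (p + t *\<^sub>R (p + \<sigma> *\<^sub>R e)) = 1" using assms(3) by auto
  have "\<bar>3 * polar h p p (t *\<^sub>R (p + \<sigma> *\<^sub>R e))\<bar> \<le> (1 / C) * norm (t *\<^sub>R (p + \<sigma> *\<^sub>R e))"
    using d(2)[of "p + t *\<^sub>R (p + \<sigma> *\<^sub>R e)"] small[OF \<sigma>(1)] tC h1 hp by simp
  also have "\<dots> \<le> (1 / C) * (t * C)"
    using small[OF \<sigma>(1)] C by (intro mult_left_mono) auto
  also have "\<dots> = t" using C by simp
  finally have "\<bar>3 * (t * polar h p p (p + \<sigma> *\<^sub>R e))\<bar> \<le> t" by (simp add: polar_scaleR[OF h])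
  then have "3 * \<bar>polar h p p (p + \<sigma> *\<^sub>R e)\<bar> \<le> 1"
    using t(1) by (simp add: abs_mult)
  moreover have "polar h p p (p + \<sigma> *\<^sub>R e) = 1 + \<sigma> * polar h p p e"
    by (simp add: polar_add[OF h] polar_scaleR[OF h] polar_diag[OF h] hp)
  moreover have "\<bar>\<sigma> * polar h p p e\<bar> \<le> 1/2"
  proof -
    have "\<bar>\<sigma> * polar h p p e\<bar> \<le> \<epsilon> * \<bar>polar h p p e\<bar>"
      using \<sigma>(1) by (simp add: abs_mult mult_right_mono)
    then show ?thesis using \<epsilon>(2) by linarith
  qed
  ultimately show False by linarith
qed

text \<open>
  By transversality a local equation of \<open>H\<close> changes sign along the ray through a point of \<open>H\<close>, hence
  also along every nearby ray, which therefore meets \<open>H\<close>.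
\<close>

lemma open_pos_cone:
  fixes h :: "'a::euclidean_space \<Rightarrow> real"
  assumes h: "cubic_form h" and H: "smooth_hypersurface H" "H \<subseteq> {x. h x = 1}"
  shows "open (pos_cone H)"
proof -
  have loc: "\<exists>\<delta>>0. ball p \<delta> \<subseteq> pos_cone H" if p: "p \<in> H" for p
  proof -
    obtain U F where U: "open U" "p \<in> U" "smooth_on U F" "H \<inter> U = {x \<in> U. F x = 0}"
      and nz: "\<forall>x\<in>U. frechet_derivative F (at x) \<noteq> (\<lambda>v. 0)"
      using H(1) p unfolding smooth_hypersurface_def by meson
    have "Ck_on 0 U F" "Ck_on (Suc 0) U F" using U(3) unfolding smooth_on_def by blast+
    then have contF: "continuous_on U F" and "F differentiable (at p)"
      using U(1,2) by (auto simp: differentiable_on_eq_differentiable_at)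
    then have F': "(F has_derivative frechet_derivative F (at p)) (at p)" (is "(F has_derivative ?F') _")
      using frechet_derivative_works by blast
    have c: "?F' p \<noteq> 0"
      using hypersurface_transversal[OF h p H(2) U(1,2) contF U(4) F'] nz U(2) by blast
    define G where "G x = ?F' p * F x" for x
    have G': "(G has_derivative (\<lambda>v. ?F' p * ?F' v)) (at p)"
      unfolding G_def by (intro derivative_intros F')
    have Gp: "G p = 0" using p U by (auto simp: G_def)
    have contG: "continuous_on U G" unfolding G_def by (intro continuous_intros contF)
    obtain \<rho> where \<rho>: "\<rho> > 0" "ball p \<rho> \<subseteq> U" using U by (meson open_contains_ball)
    have e1: "eventually (\<lambda>t. G (p + t *\<^sub>R p) > 0) (at_right 0)"
      by (rule pos_along_direction[OF G' Gp]) (use c in \<open>simp add: not_sum_power2_lt_zero flip: power2_eq_square\<close>)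
    have "((\<lambda>x. - G x) has_derivative (\<lambda>v. - (?F' p * ?F' v))) (at p)"
      by (intro derivative_intros G')
    then have e2: "eventually (\<lambda>t. - G (p + t *\<^sub>R (- p)) > 0) (at_right 0)"
      using linear_neg[OF has_derivative_linear[OF F'], of p]
      by (rule_tac pos_along_direction) (use c Gp in \<open>auto simp: not_sum_power2_lt_zero simp flip: power2_eq_square\<close>)
    have e3: "eventually (\<lambda>t. t < min 1 (\<rho> / (2 * (norm p + 1)))) (at_right 0)"
      using \<rho> by (intro eventually_at_right_0_less) (auto simp: add_nonneg_pos)
    obtain t where t: "t > 0" "G (p + t *\<^sub>R p) > 0" "G (p - t *\<^sub>R p) < 0" "t < min 1 (\<rho> / (2 * (norm p + 1)))"
      using eventually_happens'[OF _ eventually_conj[OF eventually_conj[OF e1 e2] eventually_conj[OF e3 eventually_at_right_less]]]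
      by auto
    have "2 * (norm p + 1) > 0" by (simp add: add_nonneg_pos)
    then have "t * (norm p + 1) < \<rho> / 2" using t(4) by (simp add: pos_less_divide_eq algebra_simps)
    then have tp: "t * norm p < \<rho> / 2" "t < 1" using t by (auto simp: algebra_simps)
    have inU: "(1 + s) *\<^sub>R x \<in> U" if "\<bar>s\<bar> \<le> t" "dist p x < \<rho> / 4" for s x
    proof -
      have "(1 + s) *\<^sub>R x - p = (1 + s) *\<^sub>R (x - p) + s *\<^sub>R p" by (simp add: algebra_simps)
      then have "norm ((1 + s) *\<^sub>R x - p) \<le> \<bar>1 + s\<bar> * norm (x - p) + \<bar>s\<bar> * norm p"
        by (metis norm_scaleR norm_triangle_ineq)
      also have "\<bar>1 + s\<bar> * norm (x - p) \<le> 2 * norm (x - p)"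
        using that(1) tp by (intro mult_right_mono) auto
      also have "norm (x - p) < \<rho> / 4" using that by (simp add: dist_norm norm_minus_commute)
      also have "\<bar>s\<bar> * norm p \<le> t * norm p" using that by (simp add: mult_right_mono)
      also note tp(1)
      finally have "norm ((1 + s) *\<^sub>R x - p) < \<rho>" by simp
      then show ?thesis using \<rho>(2) by (auto simp: dist_norm norm_minus_commute)
    qed
    have cont: "continuous_on (ball p (\<rho> / 4)) (\<lambda>x. G ((1 + s) *\<^sub>R x))" if "\<bar>s\<bar> \<le> t" for s
      using inU[OF that] by (intro continuous_on_compose2[OF contG] continuous_intros) auto
    have "open (ball p (\<rho> / 4) \<inter> (\<lambda>x. G ((1 + t) *\<^sub>R x)) -` {0<..})"
      "open (ball p (\<rho> / 4) \<inter> (\<lambda>x. G ((1 + (-t)) *\<^sub>R x)) -` {..<0})"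
      using t(1) by (intro continuous_open_preimage[OF cont]; simp)+
    then have "open ((ball p (\<rho> / 4) \<inter> (\<lambda>x. G ((1 + t) *\<^sub>R x)) -` {0<..}) \<inter>
        (ball p (\<rho> / 4) \<inter> (\<lambda>x. G ((1 + (-t)) *\<^sub>R x)) -` {..<0}))"
      (is "open ?N") by blast
    moreover have "p \<in> ?N" using t \<rho> by (auto simp: algebra_simps)
    ultimately obtain \<delta> where \<delta>: "\<delta> > 0" "ball p \<delta> \<subseteq> ?N" by (meson open_contains_ball)
    have "x \<in> pos_cone H" if "x \<in> ball p \<delta>" for x
    proof -
      have x: "dist p x < \<rho> / 4" "G ((1 + t) *\<^sub>R x) > 0" "G ((1 + (-t)) *\<^sub>R x) < 0"
        using \<delta>(2) that by auto
      have "continuous_on {-t..t} (\<lambda>s. G ((1 + s) *\<^sub>R x))"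
        using inU x(1) by (intro continuous_on_compose2[OF contG] continuous_intros) (auto simp: abs_le_iff)
      then have "\<exists>s\<ge>-t. s \<le> t \<and> G ((1 + s) *\<^sub>R x) = 0"
        using t x by (intro IVT') auto
      then obtain s where s: "\<bar>s\<bar> \<le> t" "G ((1 + s) *\<^sub>R x) = 0"
        by (metis abs_le_iff minus_le_iff)
      have "(1 + s) *\<^sub>R x \<in> H"
        using inU[OF s(1) x(1)] s(2) c U(4) by (auto simp: G_def)
      moreover have "x = (1 / (1 + s)) *\<^sub>R ((1 + s) *\<^sub>R x)" "1 / (1 + s) > 0" using s(1) tp by auto
      ultimately show ?thesis unfolding pos_cone_def by blast
    qed
    then show ?thesis using \<delta>(1) by blast
  qed
  show ?thesis
    unfolding open_contains_ball
  proof
    fix y assume "y \<in> pos_cone H"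
    then obtain r p where r: "r > 0" "p \<in> H" "y = r *\<^sub>R p" unfolding pos_cone_def by blast
    obtain \<delta> where \<delta>: "\<delta> > 0" "ball p \<delta> \<subseteq> pos_cone H" using loc[OF r(2)] by blast
    have "x \<in> pos_cone H" if x: "x \<in> ball y (r * \<delta>)" for x
    proof -
      have "dist y x = r * dist p (x /\<^sub>R r)"
        using r by (simp add: dist_norm scaleR_diff_right flip: norm_scaleR[of r "p - x /\<^sub>R r", simplified])
          (use r norm_scaleR[of r "p - x /\<^sub>R r"] in \<open>simp add: scaleR_diff_right\<close>)
      then have "x /\<^sub>R r \<in> pos_cone H" using x r \<delta> by auto
      then obtain r' z where "r' > 0" "z \<in> H" "x /\<^sub>R r = r' *\<^sub>R z" unfolding pos_cone_def by blast
      then have "r * r' > 0" "z \<in> H" "r *\<^sub>R (x /\<^sub>R r) = (r * r') *\<^sub>R z"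
        using r by simp_all
      moreover have "r *\<^sub>R (x /\<^sub>R r) = x" using r by simp
      ultimately show ?thesis unfolding pos_cone_def by force
    qed
    then show "\<exists>e>0. ball y e \<subseteq> pos_cone H" using r \<delta> by (intro exI[of _ "r * \<delta>"]) auto
  qed
qed

lemma cubic_scaleR: "cubic_form h \<Longrightarrow> h (c *\<^sub>R x) = c ^ 3 * h x"
  by (simp add: cubic_form_def)

lemma continuous_on_cubic: "cubic_form h \<Longrightarrow> continuous_on S h"
  by (simp add: cubic_form_def polynomial_continuous_on)

lemma pos_cone_pos:
  assumes "cubic_form h" "H \<subseteq> {x. h x = 1}" "x \<in> pos_cone H"
  shows "h x > 0"
  using assms cubic_scaleR[OF assms(1)] unfolding pos_cone_def by fastforce

lemma pos_cone_Int_level: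
  assumes "cubic_form h" "H \<subseteq> {x. h x = 1}"
  shows "pos_cone H \<inter> {x. h x = 1} = H"
proof
  show "pos_cone H \<inter> {x. h x = 1} \<subseteq> H"
  proof
    fix x assume "x \<in> pos_cone H \<inter> {x. h x = 1}"
    then obtain r y where r: "r > 0" "y \<in> H" "x = r *\<^sub>R y" "h x = 1" unfolding pos_cone_def by blast
    then have "r ^ 3 = 1 ^ 3" using cubic_scaleR[OF assms(1), of r y] assms(2) by auto
    then have "r = 1" using power_eq_imp_eq_base[of r 3 1] r(1) by simp
    then show "x \<in> H" using r by simp
  qed
  show "H \<subseteq> pos_cone H \<inter> {x. h x = 1}"
    using assms(2) unfolding pos_cone_def by (auto intro!: exI[of _ "1::real"])
qed

text \<open>
  Where \<open>h\<close> is positive, the cone is the preimage of \<open>H\<close> under the radial retraction onto the level set.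
\<close>

lemma pos_cone_relatively_closed:
  assumes h: "cubic_form h" and H: "H \<subseteq> {x. h x = 1}" "closed H"
  shows "closedin (top_of_set {x. h x > 0}) (pos_cone H)"
proof -
  define \<rho> where "\<rho> x = x /\<^sub>R root 3 (h x)" for x
  have "continuous_on {x. h x > 0} \<rho>"
    unfolding \<rho>_def using continuous_on_cubic[OF h] by (intro continuous_intros) auto
  from continuous_closedin_preimage[OF this H(2)]
  have "closedin (top_of_set {x. h x > 0}) ({x. h x > 0} \<inter> \<rho> -` H)" .
  moreover have "{x. h x > 0} \<inter> \<rho> -` H = pos_cone H"
  proof
    have "x \<in> pos_cone H" if "h x > 0" "\<rho> x \<in> H" for x
    proof -
      have "x = root 3 (h x) *\<^sub>R \<rho> x" "root 3 (h x) > 0" using that by (auto simp: \<rho>_def)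
      then show ?thesis using that unfolding pos_cone_def by blast
    qed
    then show "{x. h x > 0} \<inter> \<rho> -` H \<subseteq> pos_cone H" by blast
    show "pos_cone H \<subseteq> {x. h x > 0} \<inter> \<rho> -` H"
    proof
      fix x assume x: "x \<in> pos_cone H"
      then obtain r y where r: "r > 0" "y \<in> H" "x = r *\<^sub>R y" unfolding pos_cone_def by blast
      then have "h x = r ^ 3" using cubic_scaleR[OF h, of r y] H by auto
      then have "\<rho> x = y" using r by (simp add: \<rho>_def real_root_power_cancel)
      then show "x \<in> {x. h x > 0} \<inter> \<rho> -` H" using pos_cone_pos[OF h H(1) x] r by simp
    qed
  qed
  ultimately show ?thesis by simp
qed

text \<open>
  The cone is open and closed in \<open>{h > 0}\<close>, hence a union of components of it.
\<close>

lemma connected_subset_pos_cone: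
  fixes h :: "'a::euclidean_space \<Rightarrow> real"
  assumes h: "cubic_form h" and H: "ccpsr_manifold h H"
    and S: "connected S" "S \<subseteq> {x. h x > 0}" "S \<inter> pos_cone H \<noteq> {}"
  shows "S \<subseteq> pos_cone H"
proof -
  have H': "H \<subseteq> {x. h x = 1}" "closed H" "smooth_hypersurface H"
    using H by (auto simp: ccpsr_manifold_def psr_manifold_def)
  have "openin (top_of_set S) (S \<inter> pos_cone H)"
    using open_pos_cone[OF h H'(3,1)] by (simp add: openin_open_Int)
  moreover have "closedin (top_of_set S) (S \<inter> pos_cone H)"
  proof -
    obtain T where "closed T" "pos_cone H = {x. h x > 0} \<inter> T"
      using pos_cone_relatively_closed[OF h H'(1,2)] by (auto simp: closedin_closed)
    then have "S \<inter> pos_cone H = S \<inter> T" using S(2) by blast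
    then show ?thesis using \<open>closed T\<close> by (simp add: closedin_closed_Int)
  qed
  ultimately have "S \<inter> pos_cone H = {} \<or> S \<inter> pos_cone H = S"
    using S(1) connected_clopen by blast
  then show ?thesis using S(3) by blast
qed

section \<open>Linear changes of coordinates\<close>

text \<open>
  A CCPSR manifold is cut out of the level set by an open set, namely by its own cone. In this
  form no local equations occur, and invariance under linear maps is a matter of preimages.
\<close>

lemma sym3_ccpsr_iff:
  fixes h :: "'a::euclidean_space \<Rightarrow> real"
  shows "h \<in> sym3_ccpsr \<longleftrightarrow> cubic_form h \<and> (\<exists>W. open W \<and> W \<inter> {x. h x = 1} \<noteq> {} \<and>
     connected (W \<inter> {x. h x = 1}) \<and> closed (W \<inter> {x. h x = 1}) \<and>
     (\<forall>p \<in> W \<inter> {x. h x = 1}. hyperbolic_point h p))"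
proof
  assume "h \<in> sym3_ccpsr"
  then obtain H where h: "cubic_form h" and H: "ccpsr_manifold h H" by (auto simp: sym3_ccpsr_def)
  then have H1: "H \<subseteq> {x. h x = 1}" "smooth_hypersurface H"
    by (auto simp: ccpsr_manifold_def psr_manifold_def)
  show "cubic_form h \<and> (\<exists>W. open W \<and> W \<inter> {x. h x = 1} \<noteq> {} \<and>
     connected (W \<inter> {x. h x = 1}) \<and> closed (W \<inter> {x. h x = 1}) \<and>
     (\<forall>p \<in> W \<inter> {x. h x = 1}. hyperbolic_point h p))"
    using h H open_pos_cone[OF h H1(2,1)]
    by (intro conjI exI[of _ "pos_cone H"])
       (auto simp: pos_cone_Int_level[OF h H1(1)] ccpsr_manifold_def psr_manifold_def)
next
  assume "cubic_form h \<and> (\<exists>W. open W \<and> W \<inter> {x. h x = 1} \<noteq> {} \<and>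
     connected (W \<inter> {x. h x = 1}) \<and> closed (W \<inter> {x. h x = 1}) \<and>
     (\<forall>p \<in> W \<inter> {x. h x = 1}. hyperbolic_point h p))"
  then obtain W where h: "cubic_form h" and W: "open W" "W \<inter> {x. h x = 1} \<noteq> {}"
     "connected (W \<inter> {x. h x = 1})" "closed (W \<inter> {x. h x = 1})"
     "\<forall>p \<in> W \<inter> {x. h x = 1}. hyperbolic_point h p" by blast
  have poly: "real_polynomial_function (\<lambda>x. h x - 1)"
    using h by (auto simp: cubic_form_def intro: real_polynomial_function.intros(2))
  have "open (h -` {0<..})"
    using continuous_on_cubic[OF h] by (intro open_vimage) auto
  then have opn: "open (W \<inter> h -` {0<..})" using W by blast
  have "smooth_hypersurface (W \<inter> {x. h x = 1})"
    unfolding smooth_hypersurface_def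
  proof (intro ballI exI conjI)
    fix p assume "p \<in> W \<inter> {x. h x = 1}"
    then show "p \<in> W \<inter> h -` {0<..}" by auto
    show "open (W \<inter> h -` {0<..})" by (rule opn)
    show "smooth_on (W \<inter> h -` {0<..}) (\<lambda>x. h x - 1)" by (rule polynomial_smooth_on[OF poly])
    show "frechet_derivative (\<lambda>x. h x - 1) (at x) \<noteq> (\<lambda>v. 0)" if "x \<in> W \<inter> h -` {0<..}" for x
    proof -
      have "((\<lambda>x. h x - 1) has_derivative (\<lambda>v. frechet_derivative h (at x) v - 0)) (at x)"
        using h by (intro derivative_intros polynomial_has_derivative) (simp add: cubic_form_def)
      then have "frechet_derivative (\<lambda>x. h x - 1) (at x) = (\<lambda>v. 3 * polar h x x v)"
        using frechet_derivative_at frechet_derivative_cubic[OF h] by fastforce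
      then have "frechet_derivative (\<lambda>x. h x - 1) (at x) x > 0"
        using that by (simp add: polar_diag[OF h])
      then show ?thesis by force
    qed
    show "W \<inter> {x. h x = 1} \<inter> (W \<inter> h -` {0<..}) = {x \<in> W \<inter> h -` {0<..}. h x - 1 = 0}" by auto
  qed
  then show "h \<in> sym3_ccpsr"
    using h W by (auto simp: sym3_ccpsr_def ccpsr_manifold_def psr_manifold_def hyperbolic_def
        intro!: exI[of _ "W \<inter> {x. h x = 1}"])
qed

lemma cubic_form_compose:
  assumes "cubic_form h" "linear A"
  shows "cubic_form (h \<circ> A)"
  using assms
  by (auto simp: cubic_form_def linear_cmul intro!: real_polynomial_function_compose
      polynomial_function_bounded_linear linear_conv_bounded_linear[THEN iffD1])

lemma polar_compose:
  assumes "linear A"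
  shows "polar (h \<circ> A) x y z = polar h (A x) (A y) (A z)"
  by (simp add: polar_def linear_add[OF assms])

lemma hyperbolic_point_compose:
  fixes h :: "'a::euclidean_space \<Rightarrow> real" and A :: "'a \<Rightarrow> 'a"
  assumes h: "cubic_form h" and A: "linear A" "bij A"
  shows "hyperbolic_point (h \<circ> A) p \<longleftrightarrow> hyperbolic_point h (A p)"
proof -
  have "A v = 0 \<longleftrightarrow> v = 0" for v
    using A bij_is_inj linear_0 by (metis injD)
  moreover have surj: "\<exists>w. v = A w" for v
    using A(2) by (metis bij_pointE)
  ultimately have all: "(\<forall>v. polar h (A p) q (A v) = 0 \<and> v \<noteq> 0 \<longrightarrow> polar h (A p) (A v) (A v) < 0) \<longleftrightarrow>
      (\<forall>v. polar h (A p) q v = 0 \<and> v \<noteq> 0 \<longrightarrow> polar h (A p) v v < 0)" for q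
    by metis
  have ex: "(\<exists>q. Q (A q)) \<longleftrightarrow> (\<exists>q. Q q)" for Q using surj by metis
  show ?thesis
    unfolding hyperbolic_point_iff[OF h] hyperbolic_point_iff[OF cubic_form_compose[OF h A(1)]]
      polar_compose[OF A(1)] all comp_apply
      ex[of "\<lambda>q. polar h (A p) q q > 0 \<and> (\<forall>v. polar h (A p) q v = 0 \<and> v \<noteq> 0 \<longrightarrow> polar h (A p) v v < 0)"] ..
qed

lemma linear_inv:
  fixes A :: "'a::euclidean_space \<Rightarrow> 'a"
  assumes "linear A" "bij A"
  shows "linear (inv A)"
proof -
  obtain B where "linear B" "B \<circ> A = id"
    using linear_injective_left_inverse[OF assms(1)] assms(2) bij_is_inj by blast
  moreover from this have "inv A = B"
    using assms(2) by (metis bij_is_surj inv_unique_comp surj_iff comp_assoc fun.map_id comp_id id_comp)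
  ultimately show ?thesis by simp
qed

lemma sym3_ccpsr_compose:
  fixes h :: "'a::euclidean_space \<Rightarrow> real" and A :: "'a \<Rightarrow> 'a"
  assumes "h \<in> sym3_ccpsr" and A: "linear A" "bij A"
  shows "h \<circ> A \<in> sym3_ccpsr"
proof -
  obtain W where h: "cubic_form h" and W: "open W" "W \<inter> {x. h x = 1} \<noteq> {}"
     "connected (W \<inter> {x. h x = 1})" "closed (W \<inter> {x. h x = 1})"
     "\<forall>p \<in> W \<inter> {x. h x = 1}. hyperbolic_point h p"
    using assms(1) unfolding sym3_ccpsr_iff by blast
  have eq: "(A -` W) \<inter> {x. (h \<circ> A) x = 1} = A -` (W \<inter> {x. h x = 1})" by auto
  have lin': "linear (inv A)" by (rule linear_inv[OF A])
  have cont: "continuous_on UNIV A" "continuous_on X (inv A)" for X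
    using A(1) lin' by (simp_all add: linear_continuous_on linear_conv_bounded_linear)
  have img: "A -` X = inv A ` X" for X using A(2) by (simp add: bij_vimage_eq_inv_image)
  have "open (A -` W)" "closed (A -` (W \<inter> {x. h x = 1}))"
    using open_vimage[OF W(1) cont(1)] closed_vimage[OF W(4) cont(1)] by blast+
  moreover have "connected (A -` (W \<inter> {x. h x = 1}))"
    unfolding img by (rule connected_continuous_image[OF cont(2) W(3)])
  moreover have "A -` (W \<inter> {x. h x = 1}) \<noteq> {}" unfolding img using W(2) by blast
  moreover have "\<forall>p \<in> A -` (W \<inter> {x. h x = 1}). hyperbolic_point (h \<circ> A) p"
    using W(5) hyperbolic_point_compose[OF h A] by blast
  ultimately show ?thesis
    unfolding sym3_ccpsr_iff eq[symmetric] using cubic_form_compose[OF h A(1)] by blast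
qed

lemma gl_orbit_compose:
  fixes h :: "'a::euclidean_space \<Rightarrow> real" and A :: "'a \<Rightarrow> 'a"
  assumes A: "linear A" "bij A"
  shows "gl_orbit (h \<circ> A) = gl_orbit h"
proof
  have "linear (A \<circ> B) \<and> bij (A \<circ> B)" if "linear B" "bij B" for B :: "'a \<Rightarrow> 'a"
    using that A by (simp add: linear_compose bij_comp)
  then show "gl_orbit (h \<circ> A) \<subseteq> gl_orbit h"
    unfolding gl_orbit_def by (smt (verit, best) comp_assoc mem_Collect_eq subsetI)
  have "linear (inv A)" by (rule linear_inv[OF A])
  then have "linear (inv A \<circ> B) \<and> bij (inv A \<circ> B)" "h \<circ> B = (h \<circ> A) \<circ> (inv A \<circ> B)"
    if "linear B" "bij B" for B :: "'a \<Rightarrow> 'a"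
    using that A by (auto simp: linear_compose bij_comp bij_imp_bij_inv bij_is_surj surj_f_inv_f fun_eq_iff)
  then show "gl_orbit h \<subseteq> gl_orbit (h \<circ> A)"
    unfolding gl_orbit_def by blast
qed

section \<open>The model cubic\<close>

text \<open>
  In the coordinates \<open>a = x + w / sqrt 3\<close> and \<open>b = x - 2 w / sqrt 3\<close> the polynomial \<open>hbar\<close>
  factorises as \<open>a (a b - \<langle>s, s\<rangle>)\<close>. This form shows the weights of its monomials.
\<close>

definition model_cubic :: "real \<times> (real ^ 'k) \<times> real \<Rightarrow> real" where
  "model_cubic = (\<lambda>(a, s, b). a ^ 2 * b - a * (s \<bullet> s))"

lemma cubic_form_model: "cubic_form (model_cubic :: real \<times> (real ^ 'k) \<times> real \<Rightarrow> real)"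
proof -
  have "real_polynomial_function (\<lambda>z::real \<times> (real ^ 'k) \<times> real.
      fst z ^ 2 * snd (snd z) - fst z * (\<Sum>i\<in>UNIV. (fst (snd z) $ i) * (fst (snd z) $ i)))"
    by (intro real_polynomial_function_diff real_polynomial_function_power real_polynomial_function_sum
        real_polynomial_function.intros(4) real_polynomial_function.intros(1))
      (auto intro: bounded_linear_fst bounded_linear_compose[OF bounded_linear_snd bounded_linear_snd]
        bounded_linear_compose[OF bounded_linear_vec_nth bounded_linear_compose[OF bounded_linear_fst bounded_linear_snd]])
  moreover have "(\<lambda>z::real \<times> (real ^ 'k) \<times> real.
      fst z ^ 2 * snd (snd z) - fst z * (\<Sum>i\<in>UNIV. (fst (snd z) $ i) * (fst (snd z) $ i))) = model_cubic"
    by (auto simp: model_cubic_def inner_vec_def fun_eq_iff)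
  ultimately have "real_polynomial_function (model_cubic :: real \<times> (real ^ 'k) \<times> real \<Rightarrow> real)" by simp
  then show ?thesis
    by (auto simp: cubic_form_def model_cubic_def eval_nat_numeral algebra_simps)
qed

lemma polar_model:
  "3 * polar model_cubic (a, s, b) (a, s, b) (x, y, z) = 2 * a * b * x + a ^ 2 * z - x * (s \<bullet> s) - 2 * a * (s \<bullet> y)"
  "3 * polar model_cubic (a, s, b) (x, y, z) (x, y, z) = 2 * a * x * z + x ^ 2 * b - 2 * x * (s \<bullet> y) - a * (y \<bullet> y)"
  unfolding polar_def model_cubic_def add_Pair prod.case inner_add_left inner_add_right inner_commute[of y s]
  by (simp_all add: power2_eq_square field_simps)

text \<open>
  At \<open>p = (a, s, b)\<close> the vector \<open>p\<close> itself is the negative direction. On its complement, completing the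
  square in \<open>y\<close> exhibits minus the quadratic form as a sum of squares with positive coefficients.
\<close>

lemma hyperbolic_point_model:
  fixes s :: "real ^ 'k"
  assumes a: "a > 0" and m: "model_cubic (a, s, b) > 0"
  shows "hyperbolic_point model_cubic (a, s, b)"
  unfolding hyperbolic_point_iff[OF cubic_form_model]
proof (intro conjI exI[of _ "(a, s, b)"] allI impI)
  show "polar model_cubic (a, s, b) (a, s, b) (a, s, b) > 0"
    using m by (simp add: polar_diag[OF cubic_form_model])
  fix v assume v: "polar model_cubic (a, s, b) (a, s, b) v = 0 \<and> v \<noteq> 0"
  obtain x y z where [simp]: "v = (x, y, z)" by (cases v)
  have 0: "2 * a * b * x + a ^ 2 * z - x * (s \<bullet> s) - 2 * a * (s \<bullet> y) = 0"
    using v polar_model(1)[of a s b x y z] by simp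
  define w where "w = y - (x / a) *\<^sub>R s"
  have ww: "a ^ 2 * (w \<bullet> w) = a ^ 2 * (y \<bullet> y) - 2 * a * x * (s \<bullet> y) + x ^ 2 * (s \<bullet> s)"
    using a by (simp add: w_def inner_diff_left inner_diff_right inner_commute[of y s] power2_eq_square field_simps)
  have "a * (3 * polar model_cubic (a, s, b) v v) =
      2 * x * (a ^ 2 * z) + a * x ^ 2 * b - 2 * a * x * (s \<bullet> y) - a ^ 2 * (y \<bullet> y)"
    unfolding \<open>v = (x, y, z)\<close> polar_model(2) by (simp add: power2_eq_square algebra_simps)
  also have "a ^ 2 * z = x * (s \<bullet> s) + 2 * a * (s \<bullet> y) - 2 * a * b * x" using 0 by simp
  also have "2 * x * (x * (s \<bullet> s) + 2 * a * (s \<bullet> y) - 2 * a * b * x) + a * x ^ 2 * b - 2 * a * x * (s \<bullet> y) - a ^ 2 * (y \<bullet> y)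
      = - (a ^ 2 * (w \<bullet> w) + 3 * x ^ 2 * (a * b - s \<bullet> s))"
    unfolding ww by (simp add: power2_eq_square algebra_simps)
  finally have *: "a * (3 * polar model_cubic (a, s, b) v v) = - (a ^ 2 * (w \<bullet> w) + 3 * x ^ 2 * (a * b - s \<bullet> s))" .
  have "a * (a * b - s \<bullet> s) > 0" using m by (simp add: model_cubic_def power2_eq_square algebra_simps)
  then have pos: "a * b - s \<bullet> s > 0" using a by (simp add: zero_less_mult_iff)
  have "a ^ 2 * (w \<bullet> w) + 3 * x ^ 2 * (a * b - s \<bullet> s) > 0"
  proof (cases "x = 0")
    case True
    then have "y \<noteq> 0" using v 0 a by (auto simp: zero_prod_def)
    then show ?thesis using True a by (simp add: w_def)
  next
    case False
    then show ?thesis using pos by (intro add_nonneg_pos mult_nonneg_nonneg mult_pos_pos) auto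
  qed
  with * have "a * (3 * polar model_cubic (a, s, b) v v) < 0" by linarith
  then show "polar model_cubic (a, s, b) v v < 0" using a by (simp add: mult_less_0_iff)
qed (use m in simp)

text \<open>
  The part of the level set with \<open>a > 0\<close> is a graph over \<open>{a > 0}\<close>, hence connected. It is closed
  because the model cubic vanishes for \<open>a = 0\<close>.
\<close>

lemma model_in_sym3_ccpsr: "(model_cubic :: real \<times> (real ^ 'k) \<times> real \<Rightarrow> real) \<in> sym3_ccpsr"
  unfolding sym3_ccpsr_iff
proof (intro conjI exI[of _ "fst -` {0<..}"])
  let ?L = "{x :: real \<times> (real ^ 'k) \<times> real. model_cubic x = 1}"
  let ?W = "fst -` {0<..} :: (real \<times> (real ^ 'k) \<times> real) set"
  show "cubic_form (model_cubic :: real \<times> (real ^ 'k) \<times> real \<Rightarrow> real)" by (rule cubic_form_model)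
  show "open ?W" by (auto intro!: open_vimage continuous_intros)
  have "(1, 0, 1) \<in> ?W \<inter> ?L" by (simp add: model_cubic_def)
  then show "?W \<inter> ?L \<noteq> {}" by blast
  show "\<forall>p \<in> ?W \<inter> ?L. hyperbolic_point model_cubic p"
    by (auto intro!: hyperbolic_point_model)
  define g where "g = (\<lambda>(a, s). (a, s, (1 / a + s \<bullet> s) / a) :: real \<times> (real ^ 'k) \<times> real)"
  have "?W \<inter> ?L = g ` ({0<..} \<times> UNIV)"
  proof
    show "?W \<inter> ?L \<subseteq> g ` ({0<..} \<times> UNIV)"
    proof
      fix v assume "v \<in> ?W \<inter> ?L"
      then obtain a s b where v: "v = (a, s, b)" "a > 0" "a\<^sup>2 * b - a * (s \<bullet> s) = 1"
        by (cases v) (auto simp: model_cubic_def)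
      then have "b = (1 / a + s \<bullet> s) / a" by (simp add: field_simps power2_eq_square)
      then have "v = g (a, s)" using v(1) by (simp add: g_def)
      then show "v \<in> g ` ({0<..} \<times> UNIV)" using v(2) by blast
    qed
    show "g ` ({0<..} \<times> UNIV) \<subseteq> ?W \<inter> ?L"
      by (auto simp: g_def model_cubic_def field_simps power2_eq_square)
  qed
  moreover have "continuous_on ({0<..} \<times> UNIV) g"
    unfolding g_def case_prod_unfold by (intro continuous_intros) auto
  moreover have "connected ({0::real<..} \<times> (UNIV :: (real ^ 'k) set))"
    by (intro connected_Times) auto
  ultimately show "connected (?W \<inter> ?L)" by (metis connected_continuous_image)
  have "?W \<inter> ?L = fst -` {0..} \<inter> ?L"
    by (auto simp: model_cubic_def order_less_le)
  moreover have "closed (fst -` {0::real..} :: (real \<times> (real ^ 'k) \<times> real) set)"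
    by (auto intro!: closed_vimage continuous_intros)
  moreover have "closed ?L"
    using closed_vimage[OF closed_singleton[of "1::real"] continuous_on_cubic[OF cubic_form_model[where 'k='k]]]
    by (simp add: vimage_def)
  ultimately show "closed (?W \<inter> ?L)" by auto
qed

definition hbar_coordinates :: "real \<times> (real ^ 'k) \<times> real \<Rightarrow> real \<times> (real ^ 'k) \<times> real" where
  "hbar_coordinates = (\<lambda>(x, s, w). (x + w / sqrt 3, s, x - 2 * (w / sqrt 3)))"

lemma linear_hbar_coordinates: "linear hbar_coordinates"
  by (rule linearI) (auto simp: hbar_coordinates_def add_divide_distrib distrib_left right_diff_distrib)

lemma bij_hbar_coordinates: "bij hbar_coordinates"
proof -
  have "inj hbar_coordinates"
  proof (rule injI)
    fix v v' :: "real \<times> (real ^ 'k) \<times> real"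
    assume eq: "hbar_coordinates v = hbar_coordinates v'"
    obtain x s w x' s' w' where v: "v = (x, s, w)" "v' = (x', s', w')" by (cases v, cases v')
    have 1: "x + w / sqrt 3 = x' + w' / sqrt 3" "x - 2 * (w / sqrt 3) = x' - 2 * (w' / sqrt 3)" "s = s'"
      using eq unfolding hbar_coordinates_def v prod.case prod.inject by blast+
    then have "w / sqrt 3 = w' / sqrt 3" by argo
    then show "v = v'" using 1 v by simp
  qed
  then show ?thesis
    using linear_injective_imp_surjective[OF linear_hbar_coordinates] by (auto simp: bij_def)
qed

lemma hbar_eq_model: "hbar = model_cubic \<circ> hbar_coordinates"
proof
  fix v :: "real \<times> (real ^ 'k) \<times> real"
  obtain x s w where v: "v = (x, s, w)" by (cases v)
  define u where "u = w / sqrt 3"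
  have w: "w = sqrt 3 * u" by (simp add: u_def)
  have w2: "w ^ 2 = 3 * u ^ 2" by (simp add: w power_mult_distrib)
  have "w ^ 3 = w ^ 2 * w" by (simp add: eval_nat_numeral)
  also have "\<dots> = 3 * sqrt 3 * u ^ 3" unfolding w2 by (simp add: w eval_nat_numeral)
  finally have "2 / (3 * sqrt 3) * w ^ 3 = 2 * u ^ 3" by simp
  moreover have "1 / sqrt 3 * (s \<bullet> s) * w = (s \<bullet> s) * u" by (simp add: w)
  ultimately have "hbar v = x ^ 3 - x * (s \<bullet> s + 3 * u ^ 2) - (s \<bullet> s) * u - 2 * u ^ 3"
    by (simp add: hbar_def v w2)
  also have "\<dots> = (x + u) ^ 2 * (x - 2 * u) - (x + u) * (s \<bullet> s)"
    by (simp add: eval_nat_numeral algebra_simps)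
  finally show "hbar v = (model_cubic \<circ> hbar_coordinates) v"
    by (simp add: v model_cubic_def hbar_coordinates_def u_def)
qed

lemma hbar_in_sym3_ccpsr: "hbar \<in> sym3_ccpsr"
  unfolding hbar_eq_model
  by (intro sym3_ccpsr_compose model_in_sym3_ccpsr linear_hbar_coordinates bij_hbar_coordinates)

section \<open>The boundary of the cone\<close>

lemma frontier_pos_cone_zero:
  fixes h :: "'a::euclidean_space \<Rightarrow> real"
  assumes h: "cubic_form h" and H: "ccpsr_manifold h H" and p: "p \<in> frontier (pos_cone H)"
  shows "h p = 0"
proof -
  have H': "H \<subseteq> {x. h x = 1}" "closed H" "smooth_hypersurface H"
    using H by (auto simp: ccpsr_manifold_def psr_manifold_def)
  have opn: "open (pos_cone H)" by (rule open_pos_cone[OF h H'(3,1)])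
  have p': "p \<in> closure (pos_cone H)" "p \<notin> pos_cone H"
    using p opn by (auto simp: frontier_def interior_open)
  have "closed (h -` {0..})"
    using continuous_on_cubic[OF h] by (intro closed_vimage) auto
  then have "closure (pos_cone H) \<subseteq> h -` {0..}"
    using pos_cone_pos[OF h H'(1)] by (intro closure_minimal) (auto intro: less_imp_le)
  then have "h p \<ge> 0" using p' by auto
  moreover have "\<not> h p > 0"
  proof
    assume pos: "h p > 0"
    obtain T where T: "closed T" "pos_cone H = {x. h x > 0} \<inter> T"
      using pos_cone_relatively_closed[OF h H'(1,2)] by (auto simp: closedin_closed)
    then have "p \<in> T" using p'(1) closure_minimal[of "pos_cone H" T] by blast
    then show False using T pos p'(2) by blast
  qed
  ultimately show ?thesis by simp
qed

text \<open>
  As \<open>h\<close> is odd, the cone and its negative are disjoint, so the cone is neither empty nor everything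
  in the connected space of nonzero vectors.
\<close>

lemma frontier_pos_cone_nonzero_ex:
  fixes h :: "'a::euclidean_space \<Rightarrow> real"
  assumes h: "cubic_form h" and H: "ccpsr_manifold h H" and dim: "DIM('a) \<ge> 2"
  shows "\<exists>p. p \<in> frontier (pos_cone H) - {0}"
proof -
  have H': "H \<subseteq> {x. h x = 1}" "H \<noteq> {}"
    using H by (auto simp: ccpsr_manifold_def psr_manifold_def)
  obtain x where "x \<in> H" using H' by blast
  then have x: "x \<in> pos_cone H" unfolding pos_cone_def by (auto intro!: exI[of _ "1::real"])
  have hx: "h x > 0" by (rule pos_cone_pos[OF h H'(1) x])
  have "h (- x) = - h x" using cubic_scaleR[OF h, of "-1" x] by simp
  then have "- x \<notin> pos_cone H" using pos_cone_pos[OF h H'(1), of "-x"] hx by auto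
  moreover have "h 0 = 0" using cubic_scaleR[OF h, of 0 0] by simp
  then have "x \<noteq> 0" using hx by auto
  moreover have "connected (- {0::'a})" by (rule connected_punctured_universe[OF dim])
  moreover from calculation have "- x \<in> - {0} - pos_cone H" "x \<in> - {0} \<inter> pos_cone H" using x by simp_all
  ultimately have "(- {0}) \<inter> frontier (pos_cone H) \<noteq> {}"
    by (intro connected_Int_frontier) blast+
  then show ?thesis by blast
qed

text \<open>
  The exact difference \<open>h y - h x\<close> is this linear form applied to \<open>y - x\<close>. Unlike the derivative it
  carries no error term, which reduces the implicit function theorem for \<open>h = 0\<close> to a division.
\<close>

definition secant_form :: "('a::euclidean_space \<Rightarrow> real) \<Rightarrow> 'a \<Rightarrow> 'a \<Rightarrow> 'a \<Rightarrow> real" where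
  "secant_form h x y v = polar h y y v + polar h y x v + polar h x x v"

lemma secant_form_linear:
  assumes "cubic_form h"
  shows "secant_form h x y (a *\<^sub>R u + b *\<^sub>R v) = a * secant_form h x y u + b * secant_form h x y v"
    and "secant_form h x y (a *\<^sub>R u) = a * secant_form h x y u"
  by (simp_all add: secant_form_def polar_add[OF assms] polar_scaleR[OF assms] algebra_simps)

lemma cubic_difference_secant:
  "cubic_form h \<Longrightarrow> h y - h x = secant_form h x y (y - x)"
  by (simp add: cubic_difference secant_form_def)

lemma continuous_on_secant_form [continuous_intros]:
  assumes "cubic_form h" "continuous_on S a" "continuous_on S b"
  shows "continuous_on S (\<lambda>x. secant_form h (a x) (b x) v)"
  unfolding secant_form_def by (intro continuous_intros assms)

lemma secant_form_dominant_nbhd: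
  fixes h :: "'a::euclidean_space \<Rightarrow> real"
  assumes h: "cubic_form h" and q: "polar h p p q > 0" and v: "polar h p p v = 0" and "r > 0"
  shows "\<exists>\<rho>>0. \<rho> \<le> r \<and> (\<forall>x\<in>ball p \<rho>. \<forall>y\<in>ball p \<rho>. \<bar>secant_form h x y v\<bar> < secant_form h x y q)"
proof -
  define g where "g z = secant_form h (fst z) (snd z) q - \<bar>secant_form h (fst z) (snd z) v\<bar>" for z
  have "continuous_on UNIV g"
    unfolding g_def by (intro continuous_intros h)
  then have "open (g -` {0<..})" by (auto intro: open_vimage)
  moreover have "(p, p) \<in> g -` {0<..}" using q v by (simp add: g_def secant_form_def)
  ultimately obtain A B where AB: "open A" "open B" "(p, p) \<in> A \<times> B" "A \<times> B \<subseteq> g -` {0<..}"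
    by (rule open_prod_elim)
  have "open (A \<inter> B)" "p \<in> A \<inter> B" using AB by auto
  then obtain \<rho> where \<rho>: "\<rho> > 0" "ball p \<rho> \<subseteq> A \<inter> B"
    by (meson open_contains_ball)
  have "\<bar>secant_form h x y v\<bar> < secant_form h x y q" if "x \<in> ball p \<rho>" "y \<in> ball p \<rho>" for x y
  proof -
    have "(x, y) \<in> g -` {0<..}" using that \<rho>(2) AB(4) by blast
    then show ?thesis by (simp add: g_def)
  qed
  then show ?thesis using \<rho>(1) \<open>r > 0\<close> by (intro exI[of _ "min \<rho> r"]) auto
qed

text \<open>
  Near a boundary point with \<open>dh \<noteq> 0\<close>, the whole zero set of \<open>h\<close> bounds the cone. The cubic increases
  in direction \<open>q\<close> throughout a neighbourhood, so a point \<open>u\<close> of the cone and a point \<open>x\<close> with \<open>h x = 0\<close> can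
  both be pushed in direction \<open>q\<close> into one small ball on which \<open>h > 0\<close>. The path from \<open>u\<close> through the ball
  back towards \<open>x\<close> remains in \<open>{h > 0}\<close>, hence in the cone.
\<close>

lemma zero_set_in_frontier:
  fixes h :: "'a::euclidean_space \<Rightarrow> real"
  assumes h: "cubic_form h" and H: "ccpsr_manifold h H" and p: "p \<in> frontier (pos_cone H)"
    and q: "polar h p p q > 0"
  shows "\<exists>r>0. \<forall>x\<in>ball p r. h x = 0 \<longrightarrow> x \<in> frontier (pos_cone H)"
proof -
  have H': "H \<subseteq> {x. h x = 1}" "smooth_hypersurface H"
    using H by (auto simp: ccpsr_manifold_def psr_manifold_def)
  have hp: "h p = 0" by (rule frontier_pos_cone_zero[OF h H p])
  obtain \<rho> where \<rho>: "\<rho> > 0" "\<And>x y. x \<in> ball p \<rho> \<Longrightarrow> y \<in> ball p \<rho> \<Longrightarrow> secant_form h x y q > 0"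
    using secant_form_dominant_nbhd[OF h q polar_zero(3)[OF h], of 1] by (metis abs_ge_zero order_le_less_trans zero_less_one)
  have "q \<noteq> 0" using q polar_zero(3)[OF h] by force
  define c where "c = \<rho> / (4 * norm q)"
  have c: "c > 0" "c * norm q = \<rho> / 4" using \<rho>(1) \<open>q \<noteq> 0\<close> by (simp_all add: c_def)
  have near: "y + s *\<^sub>R q \<in> ball p \<rho>" if "y \<in> ball p (\<rho> / 2)" "0 \<le> s" "s \<le> c" for y s
  proof -
    have "dist p (y + s *\<^sub>R q) \<le> dist p y + norm (s *\<^sub>R q)"
      by (metis dist_triangle dist_add_cancel add_0_right dist_0_norm)
    also have "norm (s *\<^sub>R q) \<le> c * norm q" using that by (simp add: mult_right_mono)
    also have "dist p y + c * norm q < \<rho>" using that(1) c(2) \<rho>(1) by simp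
    finally show ?thesis by simp
  qed
  \<comment> \<open>Moving from a point with nonnegative value in direction \<open>q\<close> makes the cubic positive.\<close>
  have up: "h (y + s *\<^sub>R q) > 0" if "y \<in> ball p (\<rho> / 2)" "h y \<ge> 0" "0 < s" "s \<le> c" for y s
  proof -
    have "h (y + s *\<^sub>R q) - h y = s * secant_form h y (y + s *\<^sub>R q) q"
      by (simp add: cubic_difference_secant[OF h] secant_form_linear(2)[OF h])
    also have "\<dots> > 0" using that \<rho>(1) near by (intro mult_pos_pos \<rho>(2)) auto
    finally show ?thesis using that by simp
  qed
  have "p + c *\<^sub>R q \<in> h -` {0<..}" using up[of p c] hp c \<rho>(1) by simp
  moreover have "open (h -` {0<..})"
    using continuous_on_cubic[OF h] by (intro open_vimage) auto
  ultimately obtain r0 where r0: "r0 > 0" "ball (p + c *\<^sub>R q) r0 \<subseteq> h -` {0<..}"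
    by (meson open_contains_ball)
  define r where "r = min r0 (\<rho> / 2)"
  have r: "r > 0" "r \<le> r0" "r \<le> \<rho> / 2" using r0 \<rho> by (auto simp: r_def)
  have shift: "y + c *\<^sub>R q \<in> ball (p + c *\<^sub>R q) r" if "y \<in> ball p r" for y
    using that by simp
  obtain u where u: "u \<in> pos_cone H" "u \<in> ball p r"
    using p r(1) by (metis frontier_def DiffE closure_approachable mem_ball dist_commute)
  have S1: "(\<lambda>s. u + s *\<^sub>R q) ` {0..c} \<subseteq> pos_cone H"
  proof (rule connected_subset_pos_cone[OF h H])
    show "connected ((\<lambda>s. u + s *\<^sub>R q) ` {0..c})"
      by (intro connected_continuous_image continuous_intros) auto
    have hu: "h u > 0" by (rule pos_cone_pos[OF h H'(1) u(1)])
    have "h (u + s *\<^sub>R q) > 0" if "0 \<le> s" "s \<le> c" for s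
      using up[of u s] hu u(2) r(3) that by (cases "s = 0") auto
    then show "(\<lambda>s. u + s *\<^sub>R q) ` {0..c} \<subseteq> {x. h x > 0}" by auto
    have "u + 0 *\<^sub>R q \<in> (\<lambda>s. u + s *\<^sub>R q) ` {0..c}" using c by (intro imageI) auto
    then show "(\<lambda>s. u + s *\<^sub>R q) ` {0..c} \<inter> pos_cone H \<noteq> {}" using u(1) by auto
  qed
  have "u + c *\<^sub>R q \<in> (\<lambda>s. u + s *\<^sub>R q) ` {0..c}" using c by (intro imageI) auto
  then have "u + c *\<^sub>R q \<in> pos_cone H" using S1 by blast
  then have S2: "ball (p + c *\<^sub>R q) r \<subseteq> pos_cone H"
  proof (intro connected_subset_pos_cone[OF h H])
    show "ball (p + c *\<^sub>R q) r \<subseteq> {x. h x > 0}"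
      using order_trans[OF subset_ball[OF r(2)] r0(2)] by auto
    show "ball (p + c *\<^sub>R q) r \<inter> pos_cone H \<noteq> {}"
      using shift[OF u(2)] \<open>u + c *\<^sub>R q \<in> pos_cone H\<close> by blast
  qed simp
  have "x \<in> frontier (pos_cone H)" if x: "x \<in> ball p r" "h x = 0" for x
  proof -
    have S3: "(\<lambda>s. x + s *\<^sub>R q) ` {0<..c} \<subseteq> pos_cone H"
    proof (rule connected_subset_pos_cone[OF h H])
      show "connected ((\<lambda>s. x + s *\<^sub>R q) ` {0<..c})"
        by (intro connected_continuous_image continuous_intros) auto
      show "(\<lambda>s. x + s *\<^sub>R q) ` {0<..c} \<subseteq> {x. h x > 0}"
        using up[of x] x r(3) by auto
      have "x + c *\<^sub>R q \<in> (\<lambda>s. x + s *\<^sub>R q) ` {0<..c}" using c by (intro imageI) auto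
      then show "(\<lambda>s. x + s *\<^sub>R q) ` {0<..c} \<inter> pos_cone H \<noteq> {}" using S2 shift[OF x(1)] by blast
    qed
    have "((\<lambda>s. x + s *\<^sub>R q) \<longlongrightarrow> x + 0 *\<^sub>R q) (at_right 0)"
      by (intro tendsto_intros)
    moreover have "eventually (\<lambda>s. x + s *\<^sub>R q \<in> pos_cone H) (at_right 0)"
      using S3 c(1) by (auto simp: eventually_at_right_field image_subset_iff intro!: exI[of _ c])
    then have "eventually (\<lambda>s. x + s *\<^sub>R q \<in> closure (pos_cone H)) (at_right 0)"
      by (rule eventually_mono) (use closure_subset in blast)
    ultimately have "x + 0 *\<^sub>R q \<in> closure (pos_cone H)"
      by (intro Lim_in_closed_set[OF closed_closure, of "\<lambda>s. x + s *\<^sub>R q" _ "at_right (0::real)"]) simp_all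
    then have "x \<in> closure (pos_cone H)" by simp
    moreover have "x \<notin> pos_cone H" using pos_cone_pos[OF h H'(1), of x] x(2) by auto
    ultimately show ?thesis by (metis Diff_iff frontier_def interior_subset subsetD)
  qed
  then show ?thesis using r(1) by blast
qed

text \<open>
  The curve is \<open>\<gamma> t = p + t v + \<sigma> t q\<close>, where \<open>\<sigma> t\<close> is a zero of \<open>h\<close> on the line in direction \<open>q\<close>. Applying
  the secant form to two points of the curve gives \<open>\<sigma> t' - \<sigma> t = R t t' (t' - t)\<close> for a quotient \<open>R\<close> of
  secant forms that is bounded by \<open>1\<close>. Thus \<open>\<sigma>\<close> is Lipschitz, hence \<open>R\<close> is continuous along the curve
  and \<open>\<sigma>\<close> has the continuous derivative \<open>R t t\<close>, with \<open>R 0 0 = 0\<close>.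
\<close>

lemma zero_set_curve:
  fixes h :: "'a::euclidean_space \<Rightarrow> real"
  assumes h: "cubic_form h" and hp: "h p = 0" and q: "polar h p p q > 0"
    and v: "polar h p p v = 0" and "r > 0"
  shows "\<exists>\<epsilon> \<gamma>. \<epsilon> > 0 \<and> \<gamma> C1_differentiable_on {-\<epsilon><..<\<epsilon>} \<and>
    (\<forall>t\<in>{-\<epsilon><..<\<epsilon>}. \<gamma> t \<in> ball p r \<and> h (\<gamma> t) = 0) \<and> \<gamma> 0 = p \<and> (\<gamma> has_vector_derivative v) (at 0)"
proof -
  let ?Q = "secant_form h"
  obtain \<rho> where \<rho>: "\<rho> > 0" "\<rho> \<le> r"
    and dom: "\<And>x y. x \<in> ball p \<rho> \<Longrightarrow> y \<in> ball p \<rho> \<Longrightarrow> \<bar>?Q x y v\<bar> < ?Q x y q"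
    using secant_form_dominant_nbhd[OF h q v \<open>r > 0\<close>] by blast
  have "q \<noteq> 0" using q polar_zero(3)[OF h] by force
  define c where "c = \<rho> / (4 * norm q)"
  have c: "c > 0" "c * norm q = \<rho> / 4" using \<rho>(1) \<open>q \<noteq> 0\<close> by (simp_all add: c_def)
  have slope: "h (p + s *\<^sub>R q) = s * ?Q p (p + s *\<^sub>R q) q" for s
    using cubic_difference_secant[OF h, of "p + s *\<^sub>R q" p] hp by (simp add: secant_form_linear(2)[OF h])
  have pq: "p + s *\<^sub>R q \<in> ball p \<rho>" if "\<bar>s\<bar> \<le> c" for s
  proof -
    have "norm (s *\<^sub>R q) \<le> c * norm q" using that by (simp add: mult_right_mono)
    then show ?thesis using c(2) \<rho>(1) by (simp add: dist_norm)
  qed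
  have Qpos: "?Q x y q > 0" if "x \<in> ball p \<rho>" "y \<in> ball p \<rho>" for x y
    using dom[OF that] by linarith
  have ends: "h (p + c *\<^sub>R q) > 0" "h (p + (-c) *\<^sub>R q) < 0"
    unfolding slope using c(1) pq[of c] pq[of "-c"] \<rho>(1)
    by (auto intro!: mult_pos_pos mult_neg_pos Qpos simp del: scaleR_minus_left)
  have conts: "continuous_on UNIV (\<lambda>t. h (p + t *\<^sub>R v + s *\<^sub>R q))" for s
    by (intro continuous_on_compose2[OF continuous_on_cubic[OF h, of UNIV]] continuous_intros) auto
  have "open ((\<lambda>t. h (p + t *\<^sub>R v + c *\<^sub>R q)) -` {0<..} \<inter> (\<lambda>t. h (p + t *\<^sub>R v + (-c) *\<^sub>R q)) -` {..<0} \<inter>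
      (\<lambda>t. norm (t *\<^sub>R v)) -` {..<\<rho> / 2})" (is "open ?N")
    using conts[of c] conts[of "-c"] by (auto intro!: open_Int open_vimage continuous_intros)
  moreover have "0 \<in> ?N" using ends \<rho>(1) by simp
  ultimately obtain \<epsilon> where \<epsilon>: "\<epsilon> > 0" "ball 0 \<epsilon> \<subseteq> ?N" by (meson open_contains_ball)
  define I where "I = {-\<epsilon><..<\<epsilon>}"
  have "I = ball 0 \<epsilon>" by (auto simp: I_def)
  then have I: "open I" "0 \<in> I" "I \<subseteq> ?N" using \<epsilon> by simp_all
  have "\<exists>s. \<bar>s\<bar> \<le> c \<and> h (p + t *\<^sub>R v + s *\<^sub>R q) = 0" if "t \<in> I" for t
  proof -
    have "h (p + t *\<^sub>R v + c *\<^sub>R q) > 0" "h (p + t *\<^sub>R v + (-c) *\<^sub>R q) < 0"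
      using that I(3) by auto
    moreover have "continuous_on {-c..c} (\<lambda>s. h (p + t *\<^sub>R v + s *\<^sub>R q))"
      by (intro continuous_on_compose2[OF continuous_on_cubic[OF h, of UNIV]] continuous_intros) auto
    ultimately have "\<exists>s\<ge>-c. s \<le> c \<and> h (p + t *\<^sub>R v + s *\<^sub>R q) = 0"
      using c(1) by (intro IVT') auto
    then show ?thesis by (metis abs_le_iff minus_le_iff)
  qed
  then obtain \<sigma> where \<sigma>: "\<And>t. t \<in> I \<Longrightarrow> \<bar>\<sigma> t\<bar> \<le> c" "\<And>t. t \<in> I \<Longrightarrow> h (p + t *\<^sub>R v + \<sigma> t *\<^sub>R q) = 0"
    by metis
  define \<gamma> where "\<gamma> t = p + t *\<^sub>R v + \<sigma> t *\<^sub>R q" for t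
  have \<gamma>B: "\<gamma> t \<in> ball p \<rho>" if "t \<in> I" for t
  proof -
    have "norm (t *\<^sub>R v + \<sigma> t *\<^sub>R q) \<le> norm (t *\<^sub>R v) + norm (\<sigma> t *\<^sub>R q)" by (rule norm_triangle_ineq)
    also have "norm (\<sigma> t *\<^sub>R q) \<le> c * norm q" using \<sigma>(1)[OF that] by (simp add: mult_right_mono)
    also have "norm (t *\<^sub>R v) < \<rho> / 2" using that I(3) by auto
    finally have "norm (t *\<^sub>R v + \<sigma> t *\<^sub>R q) < \<rho>" using c(2) \<rho>(1) by simp
    moreover have "dist (\<gamma> t) p = norm (t *\<^sub>R v + \<sigma> t *\<^sub>R q)" by (simp add: \<gamma>_def dist_norm)
    ultimately show ?thesis by (simp add: dist_commute)
  qed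
  have \<gamma>0: "h (\<gamma> t) = 0" if "t \<in> I" for t using \<sigma>(2)[OF that] by (simp add: \<gamma>_def)
  have Qg: "?Q (\<gamma> t) (\<gamma> t') q > 0" if "t \<in> I" "t' \<in> I" for t t' using Qpos \<gamma>B that by blast
  define R where "R t t' = - ?Q (\<gamma> t) (\<gamma> t') v / ?Q (\<gamma> t) (\<gamma> t') q" for t t'
  have diff: "\<sigma> t' - \<sigma> t = R t t' * (t' - t)" if "t \<in> I" "t' \<in> I" for t t'
  proof -
    have "\<gamma> t' - \<gamma> t = (t' - t) *\<^sub>R v + (\<sigma> t' - \<sigma> t) *\<^sub>R q"
      by (simp add: \<gamma>_def algebra_simps)
    then have "(t' - t) * ?Q (\<gamma> t) (\<gamma> t') v + (\<sigma> t' - \<sigma> t) * ?Q (\<gamma> t) (\<gamma> t') q = 0"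
      using cubic_difference_secant[OF h, of "\<gamma> t'" "\<gamma> t"] \<gamma>0 that by (simp add: secant_form_linear(1)[OF h])
    then show ?thesis using Qg[OF that] unfolding R_def by (simp add: field_simps)
  qed
  have R1: "\<bar>R t t'\<bar> \<le> 1" if "t \<in> I" "t' \<in> I" for t t'
    using dom[OF \<gamma>B[OF that(1)] \<gamma>B[OF that(2)]] by (simp add: R_def)
  have cont\<sigma>: "continuous_on I \<sigma>"
  proof (rule lipschitz_on_continuous_on)
    show "1-lipschitz_on I \<sigma>"
    proof (rule lipschitz_onI)
      show "dist (\<sigma> t) (\<sigma> t') \<le> 1 * dist t t'" if "t \<in> I" "t' \<in> I" for t t'
        using diff[OF that(2,1)] mult_right_mono[OF R1[OF that(2,1)], of "\<bar>t - t'\<bar>"]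
        by (simp add: dist_real_def abs_mult)
    qed simp
  qed
  have cont\<gamma>: "continuous_on I \<gamma>" unfolding \<gamma>_def by (intro continuous_intros cont\<sigma>)
  have contR: "continuous_on I (R t)" if "t \<in> I" for t
    unfolding R_def using Qg[OF that] by (intro continuous_intros h cont\<gamma>) force+
  have contRR: "continuous_on I (\<lambda>t. R t t)"
    unfolding R_def using Qg by (intro continuous_intros h cont\<gamma>) force+
  have d\<sigma>: "(\<sigma> has_real_derivative R t t) (at t)" if "t \<in> I" for t
    unfolding has_field_derivative_iff
  proof (rule Lim_transform_within_open[OF _ I(1) that])
    show "R t \<midarrow>t\<rightarrow> R t t"
      using contR[OF that] I(1) that by (simp add: continuous_on_eq_continuous_at isContD)
    show "R t t' = (\<sigma> t' - \<sigma> t) / (t' - t)" if "t' \<in> I" "t' \<noteq> t" for t'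
      using diff[OF \<open>t \<in> I\<close> that(1)] that(2) by simp
  qed
  have d\<gamma>: "(\<gamma> has_vector_derivative (v + R t t *\<^sub>R q)) (at t)" if "t \<in> I" for t
    unfolding \<gamma>_def using d\<sigma>[OF that] 
    by (auto intro!: derivative_eq_intros simp: has_real_derivative_iff_has_vector_derivative)
  have "\<sigma> 0 = 0"
  proof (rule ccontr)
    assume "\<sigma> 0 \<noteq> 0"
    moreover have "\<sigma> 0 * ?Q p (p + \<sigma> 0 *\<^sub>R q) q = 0" using \<sigma>(2)[OF I(2)] slope by simp
    moreover have "?Q p (p + \<sigma> 0 *\<^sub>R q) q > 0" using \<rho>(1) pq[OF \<sigma>(1)[OF I(2)]] by (intro Qpos) auto
    ultimately show False by simp
  qed
  then have \<gamma>p: "\<gamma> 0 = p" by (simp add: \<gamma>_def)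
  then have "R 0 0 = 0" using v by (simp add: R_def secant_form_def)
  then have "(\<gamma> has_vector_derivative v) (at 0)" using d\<gamma>[OF I(2)] by simp
  moreover have "\<gamma> C1_differentiable_on I"
    unfolding C1_differentiable_on_def using d\<gamma> contRR
    by (intro exI[of _ "\<lambda>t. v + R t t *\<^sub>R q"]) (auto intro!: continuous_intros)
  ultimately show ?thesis
    using \<epsilon>(1) \<gamma>B \<gamma>0 \<gamma>p \<rho>(2) unfolding I_def by (intro exI[of _ \<epsilon>] exI[of _ \<gamma>]) force
qed

lemma tangent_space_frontier:
  fixes h :: "'a::euclidean_space \<Rightarrow> real"
  assumes h: "cubic_form h" and H: "ccpsr_manifold h H" and p: "p \<in> frontier (pos_cone H) - {0}"
    and q: "polar h p p q > 0"
  shows "tangent_space (frontier (pos_cone H) - {0}) p = {v. polar h p p v = 0}"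
proof
  show "tangent_space (frontier (pos_cone H) - {0}) p \<subseteq> {v. polar h p p v = 0}"
  proof
    fix v assume "v \<in> tangent_space (frontier (pos_cone H) - {0}) p"
    then obtain \<epsilon> \<gamma> where \<gamma>: "\<epsilon> > 0" "\<gamma> ` {-\<epsilon><..<\<epsilon>} \<subseteq> frontier (pos_cone H) - {0}" "\<gamma> 0 = p"
      "(\<gamma> has_vector_derivative v) (at 0)"
      unfolding tangent_space_def by blast
    have zero: "h (\<gamma> t) = 0" if "t \<in> {-\<epsilon><..<\<epsilon>}" for t
      using \<gamma>(2) that frontier_pos_cone_zero[OF h H] by blast
    have "(h has_derivative frechet_derivative h (at (\<gamma> 0))) (at (\<gamma> 0))"
      using h by (intro polynomial_has_derivative) (simp add: cubic_form_def)
    from has_derivative_compose[OF \<gamma>(4)[unfolded has_vector_derivative_def] this]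
    have "((\<lambda>t. h (\<gamma> t)) has_derivative (\<lambda>t. frechet_derivative h (at p) (t *\<^sub>R v))) (at 0)"
      by (simp add: \<gamma>(3))
    moreover have "((\<lambda>t. h (\<gamma> t)) has_derivative (\<lambda>t. 0)) (at 0)"
      by (rule has_derivative_transform_within_open[where f="\<lambda>t. 0" and s="{-\<epsilon><..<\<epsilon>}"])
        (use zero \<gamma>(1) in auto)
    ultimately have "(\<lambda>t. frechet_derivative h (at p) (t *\<^sub>R v)) = (\<lambda>t. 0)"
      by (rule has_derivative_unique)
    from fun_cong[OF this, of 1] show "v \<in> {v. polar h p p v = 0}"
      by (simp add: frechet_derivative_cubic[OF h])
  qed
  show "{v. polar h p p v = 0} \<subseteq> tangent_space (frontier (pos_cone H) - {0}) p"
  proof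
    fix v assume "v \<in> {v. polar h p p v = 0}"
    then have v: "polar h p p v = 0" by simp
    have p': "p \<in> frontier (pos_cone H)" "p \<noteq> 0" using p by auto
    obtain r where r: "r > 0" "\<forall>x\<in>ball p r. h x = 0 \<longrightarrow> x \<in> frontier (pos_cone H)"
      using zero_set_in_frontier[OF h H p'(1) q] by blast
    obtain \<epsilon> \<gamma> where \<gamma>: "\<epsilon> > 0" "\<gamma> C1_differentiable_on {-\<epsilon><..<\<epsilon>}"
      "\<forall>t\<in>{-\<epsilon><..<\<epsilon>}. \<gamma> t \<in> ball p (min r (norm p)) \<and> h (\<gamma> t) = 0"
      "\<gamma> 0 = p" "(\<gamma> has_vector_derivative v) (at 0)"
      using zero_set_curve[OF h frontier_pos_cone_zero[OF h H p'(1)] q v, of "min r (norm p)"] r(1) p'(2)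
      by auto
    have "\<gamma> t \<in> frontier (pos_cone H) - {0}" if "t \<in> {-\<epsilon><..<\<epsilon>}" for t
    proof -
      have "dist p (\<gamma> t) < r" "dist p (\<gamma> t) < norm p" "h (\<gamma> t) = 0" using \<gamma>(3) that by auto
      then show ?thesis using r(2) by auto
    qed
    then have "\<gamma> ` {-\<epsilon><..<\<epsilon>} \<subseteq> frontier (pos_cone H) - {0}" by (rule image_subsetI)
    with \<gamma>(1,2,4,5) show "v \<in> tangent_space (frontier (pos_cone H) - {0}) p"
      unfolding tangent_space_def by (intro CollectI exI[of _ \<epsilon>] exI[of _ \<gamma>] conjI)
  qed
qed

section \<open>Degeneration to the model at a boundary point\<close>

text \<open>
  Let \<open>K\<close> be the kernel of \<open>dh\<close> at \<open>p\<close>. As \<open>h p = 0\<close>, the vector \<open>p\<close> lies in \<open>K\<close> and spans the kernel of the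
  semidefinite Hessian on \<open>K\<close>, so that the Hessian is definite on the complement \<open>K'\<close> of \<open>p\<close> in \<open>K\<close>. The
  frame consists of \<open>p\<close>, a basis of \<open>K'\<close> that is orthonormal for \<open>- 3 * polar h p\<close>, and a vector transversal
  to \<open>K\<close>.
\<close>

lemma boundary_frame:
  fixes h :: "'a::euclidean_space \<Rightarrow> real"
  assumes h: "cubic_form h" and hp: "h p = 0" and q: "polar h p p q > 0"
    and psd: "psd_one_dim_kernel_on {v. polar h p p v = 0} (\<lambda>u v. - hessian h p u v)"
    and dim: "DIM('a) = CARD('k::finite) + 2"
  obtains M :: "real \<times> (real ^ 'k) \<times> real \<Rightarrow> 'a" where
    "linear M" "inj M" "M (1, 0, 0) = p" "3 * polar h p p (M (0, 0, 1)) = 1"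
    "\<And>s. polar h p p (M (0, s, 0)) = 0"
    "\<And>s. 3 * polar h p (M (0, s, 0)) (M (0, s, 0)) = - (s \<bullet> s)"
proof -
  define K where "K = {v. polar h p p v = 0}"
  define K' where "K' = {v \<in> K. v \<bullet> p = 0}"
  have "p \<noteq> 0" using q polar_zero(1)[OF h] by force
  then have pp: "p \<bullet> p > 0" by simp
  have Kp: "p \<in> K" using hp by (simp add: K_def polar_diag[OF h])
  have subK: "subspace K"
    by (auto simp: K_def subspace_def polar_zero[OF h] polar_add[OF h] polar_scaleR[OF h])
  have subK': "subspace K'"
    using subK by (auto simp: K'_def subspace_def inner_add_left)
  have pK': "p \<notin> K'" using pp by (auto simp: K'_def)
  have dimK': "dim K' = CARD('k)"
  proof -
    have "span (insert p K') = K"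
    proof
      show "span (insert p K') \<subseteq> K" using Kp subK by (intro span_minimal) (auto simp: K'_def)
      have "v - (v \<bullet> p / (p \<bullet> p)) *\<^sub>R p \<in> K'" if "v \<in> K" for v
        using that Kp subK pp unfolding K'_def by (auto simp: subspace_diff subspace_scale inner_diff_left)
      then show "K \<subseteq> span (insert p K')"
        unfolding span_insert using subK' by (force simp: span_eq_iff[THEN iffD2])
    qed
    have qK: "q \<notin> K" using q by (simp add: K_def)
    have "v - (polar h p p v / polar h p p q) *\<^sub>R q \<in> K" for v
      using q by (simp add: K_def polar_diff[OF h] polar_scaleR[OF h])
    then have "span (insert q K) = UNIV"
      unfolding span_insert using subK by (force simp: span_eq_iff[THEN iffD2])
    then have "DIM('a) = dim (insert q K)" by (metis dim_UNIV dim_span)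
    also have "\<dots> = dim K + 1" using qK subK by (simp add: dim_insert span_eq_iff[THEN iffD2])
    also have "dim K = dim (insert p K')" using \<open>span (insert p K') = K\<close> dim_span by metis
    also have "\<dots> = dim K' + 1" using pK' subK' by (simp add: dim_insert span_eq_iff[THEN iffD2])
    finally show ?thesis using dim by simp
  qed
  have nonpos: "polar h p u u \<le> 0" if "u \<in> K" for u
    using psd that by (auto simp: psd_one_dim_kernel_on_def hessian_cubic[OF h] K_def)
  have neg: "polar h p v v < 0" if v: "v \<in> K'" "v \<noteq> 0" for v
  proof (rule ccontr)
    assume "\<not> ?thesis"
    then have vv: "polar h p v v = 0" using nonpos[of v] v by (auto simp: K'_def)
    have vw: "polar h p v w = 0" if w: "w \<in> K" for w
    proof (rule ccontr)
      assume b: "polar h p v w \<noteq> 0"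
      \<comment> \<open>On the line \<open>t v + w\<close> the quadratic form is affine in \<open>t\<close>; this \<open>t\<close> makes its value \<open>1\<close>.\<close>
      define t where "t = (1 - polar h p w w) / (2 * polar h p v w)"
      have "t *\<^sub>R v + w \<in> K" using v w subK by (auto simp: K'_def subspace_add subspace_scale)
      then have "polar h p (t *\<^sub>R v + w) (t *\<^sub>R v + w) \<le> 0" by (rule nonpos)
      moreover have "polar h p (t *\<^sub>R v + w) (t *\<^sub>R v + w) = 2 * t * polar h p v w + polar h p w w"
        using polar_commute23[of h p w v] vv by (simp add: polar_add[OF h] polar_scaleR[OF h])
      moreover have "2 * t * polar h p v w = 1 - polar h p w w" using b by (simp add: t_def)
      ultimately show False by simp
    qed
    define R where "R = {u \<in> K. \<forall>w\<in>K. polar h p u w = 0}"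
    have "R = {u \<in> K. \<forall>w\<in>K. - hessian h p u w = 0}" by (simp add: R_def hessian_cubic[OF h])
    then have "dim R = 1" using psd by (simp add: psd_one_dim_kernel_on_def K_def)
    have "{p, v} \<subseteq> R" using Kp v vw by (auto simp: R_def K'_def K_def)
    moreover have "v \<bullet> p = 0" using v by (simp add: K'_def)
    then have "independent {p, v}" using v(2) \<open>p \<noteq> 0\<close>
      by (intro pairwise_orthogonal_independent) (auto simp: pairwise_def orthogonal_def inner_commute)
    moreover have "p \<noteq> v" using v(1) pK' by blast
    then have "card {p, v} = 2" by simp
    ultimately have "2 \<le> dim R" using independent_card_le_dim by metis
    then show False using \<open>dim R = 1\<close> by simp
  qed
  have "\<And>u v. polar h p u v = polar h p v u" "\<And>u. linear (polar h p u)"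
    by (rule polar_commute23, rule polar_linear[OF h])
  from symmetric_bilinear_eigenbasis[OF this subK']
  obtain E \<mu> where E: "E \<subseteq> K'" "pairwise orthogonal E" "\<forall>e\<in>E. norm e = 1" "span E = K'"
    "\<forall>e\<in>E. \<forall>v\<in>K'. polar h p e v = \<mu> e * (e \<bullet> v)" by blast
  have "0 \<notin> E" using E(3) by force
  then have indE: "independent E" using E(2) pairwise_orthogonal_independent by blast
  then have "finite E" "card E = CARD('k)"
    using independent_bound dim_span_eq_card_independent[OF indE] dimK' E(4) by auto
  then obtain f where f: "bij_betw f (UNIV :: 'k set) E"
    using finite_same_card_bij[of "UNIV :: 'k set" E] by auto
  have fE: "f i \<in> E" for i using f by (auto simp: bij_betw_def)
  have ee: "e \<bullet> e = 1" if "e \<in> E" for e using E(3) that by (simp add: norm_eq_1)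
  have \<mu>neg: "\<mu> e < 0" if "e \<in> E" for e
    using neg[of e] E(1,5) ee[OF that] that \<open>0 \<notin> E\<close> by (metis mult.right_neutral subsetD)
  define \<kappa> where "\<kappa> i = (1 / sqrt (- 3 * \<mu> (f i))) *\<^sub>R f i" for i
  have \<kappa>K': "\<kappa> i \<in> K'" for i unfolding \<kappa>_def using fE E(1) subK' by (intro subspace_scale) blast+
  have \<kappa>\<kappa>: "3 * polar h p (\<kappa> i) (\<kappa> j) = (if i = j then - 1 else 0)" for i j
  proof -
    have *: "polar h p (f i) (f j) = \<mu> (f i) * (f i \<bullet> f j)" using E(1,5) fE by blast
    show ?thesis
    proof (cases "i = j")
      case True
      have "sqrt (- 3 * \<mu> (f i)) * sqrt (- 3 * \<mu> (f i)) = - 3 * \<mu> (f i)"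
        using \<mu>neg[OF fE, of i] by simp
      then show ?thesis using \<mu>neg[OF fE, of i] True *
        by (simp add: \<kappa>_def polar_scaleR[OF h] ee[OF fE] field_simps)
    next
      case False
      then have "f i \<noteq> f j" using f by (auto simp: bij_betw_def inj_eq)
      then have "f i \<bullet> f j = 0"
        using E(2) fE[of i] fE[of j] by (simp add: pairwise_def orthogonal_def)
      then show ?thesis using False * by (simp add: \<kappa>_def polar_scaleR[OF h])
    qed
  qed
  define k where "k s = (\<Sum>i\<in>UNIV. (s $ i) *\<^sub>R \<kappa> i)" for s :: "real ^ 'k"
  have kK': "k s \<in> K'" for s unfolding k_def by (intro subspace_sum subK' subspace_scale \<kappa>K')
  have kk: "3 * polar h p (k s) (k s) = - (s \<bullet> s)" for s
  proof -
    have lin: "linear (polar h p u)" "linear (\<lambda>x. polar h p x u)" for u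
      by (rule polar_linear_slots[OF h])+
    have "3 * polar h p (k s) (k s) = (\<Sum>i\<in>UNIV. \<Sum>j\<in>UNIV. s $ i * (s $ j * (3 * polar h p (\<kappa> i) (\<kappa> j))))"
      unfolding k_def
      by (simp add: linear_sum[OF lin(1)] linear_sum[OF lin(2)] polar_scaleR[OF h] sum_distrib_left mult_ac)
        (subst sum.swap, simp add: mult_ac)
    also have "\<dots> = - (\<Sum>i\<in>UNIV. s $ i * s $ i)"
      unfolding \<kappa>\<kappa> by (simp add: if_distrib sum_negf cong: if_cong)
    finally show ?thesis by (simp add: inner_vec_def)
  qed
  define q' where "q' = (1 / (3 * polar h p p q)) *\<^sub>R q"
  have q': "3 * polar h p p q' = 1" using q by (simp add: q'_def polar_scaleR[OF h])
  define M where "M = (\<lambda>(a, s, b). a *\<^sub>R p + k s + b *\<^sub>R q')"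
  have k0: "k 0 = 0" by (simp add: k_def)
  show ?thesis
  proof
    show "linear M"
      by (rule linearI) (auto simp: M_def k_def algebra_simps sum.distrib scaleR_sum_right)
    then have "M v = 0 \<longrightarrow> v = 0" for v
    proof -
      obtain a s b where v: "v = (a, s, b)" by (cases v)
      have "a = 0 \<and> s = 0 \<and> b = 0" if M0: "a *\<^sub>R p + k s + b *\<^sub>R q' = 0"
      proof -
        have "polar h p p (a *\<^sub>R p + k s + b *\<^sub>R q') = 0" using M0 polar_zero[OF h] by simp
        then have b: "b = 0"
          using q' kK'[of s] Kp by (simp add: polar_add[OF h] polar_scaleR[OF h] K'_def K_def)
        have "(a *\<^sub>R p + k s) \<bullet> p = 0" using M0 b by simp
        then have a: "a = 0" using kK'[of s] pp by (simp add: inner_add_left K'_def)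
        have "s \<bullet> s = 0" using kk[of s] M0 a b polar_zero[OF h] by simp
        then show ?thesis using a b by simp
      qed
      then show ?thesis by (simp add: M_def v zero_prod_def)
    qed
    then show "inj M" using linear_injective_0[OF \<open>linear M\<close>] by blast
    show "M (1, 0, 0) = p" "3 * polar h p p (M (0, 0, 1)) = 1" using q' by (simp_all add: M_def k0)
    show "polar h p p (M (0, s, 0)) = 0" for s using kK'[of s] by (simp add: M_def K'_def K_def)
    show "3 * polar h p (M (0, s, 0)) (M (0, s, 0)) = - (s \<bullet> s)" for s using kk[of s] by (simp add: M_def)
  qed
qed

text \<open>
  Weights \<open>- 2\<close>, \<open>1\<close>, \<open>4\<close> for \<open>a\<close>, \<open>s\<close>, \<open>b\<close>: exactly those for which \<open>a\<^sup>2 b\<close> and \<open>a \<langle>s, s\<rangle>\<close> have weight \<open>0\<close>,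
  normalised by giving \<open>s\<close> weight \<open>1\<close>.
\<close>

definition weighted_scaling :: "real \<Rightarrow> real \<times> (real ^ 'k) \<times> real \<Rightarrow> real \<times> (real ^ 'k) \<times> real" where
  "weighted_scaling l = (\<lambda>(a, s, b). (a / l ^ 2, l *\<^sub>R s, l ^ 4 * b))"

lemma linear_weighted_scaling: "linear (weighted_scaling l)"
  by (rule linearI) (auto simp: weighted_scaling_def add_divide_distrib scaleR_add_right distrib_left)

lemma inj_weighted_scaling: "l \<noteq> 0 \<Longrightarrow> inj (weighted_scaling l)"
  by (auto simp: inj_def weighted_scaling_def)

text \<open>
  In the frame of a boundary point the monomials \<open>a\<^sup>3\<close> and \<open>a\<^sup>2 s\<close>, which have negative weight, are
  absent: their coefficients are \<open>h p\<close> and the values of \<open>dh\<close> at \<open>p\<close> on \<open>K\<close>. The two monomials of weight \<open>0\<close>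
  form the model cubic, and all others have positive weight and disappear in the limit.
\<close>

lemma degeneration_to_model:
  fixes h :: "'a::euclidean_space \<Rightarrow> real" and M :: "real \<times> (real ^ 'k) \<times> real \<Rightarrow> 'a"
  assumes h: "cubic_form h" and hp: "h p = 0"
    and M: "linear M" "M (1, 0, 0) = p" "3 * polar h p p (M (0, 0, 1)) = 1"
    "\<And>s. polar h p p (M (0, s, 0)) = 0"
    "\<And>s. 3 * polar h p (M (0, s, 0)) (M (0, s, 0)) = - (s \<bullet> s)"
  shows "((\<lambda>l. h (M (weighted_scaling l x))) \<longlongrightarrow> model_cubic x) (at 0)"
proof -
  obtain a s b where x: "x = (a, s, b)" by (cases x)
  define k where "k = M (0, s, 0)"
  define q where "q = M (0, 0, 1)"
  have Mx: "M (u, r *\<^sub>R s, w) = u *\<^sub>R p + (r *\<^sub>R k + w *\<^sub>R q)" for u r w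
  proof -
    have "(u, r *\<^sub>R s, w) = u *\<^sub>R (1, 0, 0) + (r *\<^sub>R (0, s, 0) + w *\<^sub>R (0, 0, 1))" by simp
    then show ?thesis unfolding k_def q_def M(2)[symmetric]
      by (metis linear_add[OF M(1)] linear_cmul[OF M(1)])
  qed
  have ppq: "3 * polar h p p q = 1" and ppk: "polar h p p k = 0" and pkk: "3 * polar h p k k = - (s \<bullet> s)"
    using M by (simp_all add: q_def k_def)
  define g where "g l = model_cubic x + 6 * a * b * l ^ 3 * polar h p k q + 3 * a * b ^ 2 * l ^ 6 * polar h p q q
     + l ^ 3 * h (k + (l ^ 3 * b) *\<^sub>R q)" for l
  have eq: "h (M (weighted_scaling l x)) = g l" if l: "l \<noteq> 0" for l
  proof -
    define \<alpha> where "\<alpha> = a / l ^ 2"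
    have a: "a = \<alpha> * l ^ 2" using l by (simp add: \<alpha>_def)
    define y where "y = k + (l ^ 3 * b) *\<^sub>R q"
    have "M (weighted_scaling l x) = \<alpha> *\<^sub>R p + l *\<^sub>R y"
      by (simp add: x weighted_scaling_def Mx y_def \<alpha>_def scaleR_add_right eval_nat_numeral mult_ac)
    then have "h (M (weighted_scaling l x))
       = 3 * \<alpha> ^ 2 * l * polar h p p y + \<alpha> * l ^ 2 * (3 * polar h p y y) + l ^ 3 * h y"
      by (simp add: cubic_add[OF h] polar_scaleR[OF h] cubic_scaleR[OF h] hp power2_eq_square)
    also have "polar h p p y = l ^ 3 * b * polar h p p q"
      by (simp add: y_def polar_add[OF h] polar_scaleR[OF h] ppk)
    also have "3 * polar h p y y = - (s \<bullet> s) + 6 * l ^ 3 * b * polar h p k q + 3 * (l ^ 3 * b) ^ 2 * polar h p q q"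
      using polar_commute23[of h p q k] pkk
      by (simp add: y_def polar_add[OF h] polar_scaleR[OF h] power2_eq_square algebra_simps)
    also have "3 * \<alpha>\<^sup>2 * l * (l ^ 3 * b * polar h p p q) = a ^ 2 * b"
    proof -
      have "3 * \<alpha>\<^sup>2 * l * (l ^ 3 * b * polar h p p q) = \<alpha>\<^sup>2 * l * (l ^ 3 * b * (3 * polar h p p q))" by simp
      also have "\<dots> = a ^ 2 * b" unfolding ppq a by (simp add: eval_nat_numeral)
      finally show ?thesis .
    qed
    also have "\<alpha> * l ^ 2 = a" by (simp add: a)
    finally show ?thesis
      unfolding g_def by (simp add: x model_cubic_def y_def eval_nat_numeral algebra_simps)
  qed
  have "continuous_on UNIV g"
    unfolding g_def
    by (intro continuous_intros continuous_on_compose2[OF continuous_on_cubic[OF h, of UNIV]]) auto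
  then have "(g \<longlongrightarrow> g 0) (at 0)"
    by (simp add: continuous_on_eq_continuous_at isContD)
  moreover have "eventually (\<lambda>l. g l = h (M (weighted_scaling l x))) (at 0)"
    using eq by (auto simp: eventually_at_filter)
  ultimately have "((\<lambda>l. h (M (weighted_scaling l x))) \<longlongrightarrow> g 0) (at 0)"
    by (rule Lim_transform_eventually)
  then show ?thesis by (simp add: g_def)
qed

section \<open>Non-separation\<close>

text \<open>
  Every boundary point of the cone provides such a degeneration; regularity makes \<open>dh\<close> nonzero there
  and gives the required semidefiniteness on the tangent space, which is the kernel of \<open>dh\<close>.
\<close>

lemma orbit_of_regular_degenerates:
  fixes h :: "real \<times> (real ^ 'k) \<times> real \<Rightarrow> real"
  assumes "h \<in> sym3_ccpsr_reg"
  shows "\<exists>A :: nat \<Rightarrow> real \<times> (real ^ 'k) \<times> real \<Rightarrow> real \<times> (real ^ 'k) \<times> real.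
    (\<forall>n. linear (A n) \<and> bij (A n)) \<and> (\<forall>x. (\<lambda>n. h (A n x)) \<longlonglongrightarrow> hbar x)"
proof -
  obtain H where h: "cubic_form h" and H: "ccpsr_manifold h H" and reg: "regular_boundary_behaviour h H"
    using assms by (auto simp: sym3_ccpsr_reg_def)
  have dim: "DIM(real \<times> (real ^ 'k) \<times> real) = CARD('k) + 2" by simp
  have "DIM(real \<times> (real ^ 'k) \<times> real) \<ge> 2" by simp
  then obtain p where p: "p \<in> frontier (pos_cone H) - {0}"
    using frontier_pos_cone_nonzero_ex[OF h H] by blast
  have hp: "h p = 0" using frontier_pos_cone_zero[OF h H] p by blast
  have "frechet_derivative h (at p) \<noteq> (\<lambda>v. 0)"
    using reg p unfolding regular_boundary_behaviour_def singular_at_infinity_def by blast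
  then obtain q0 where q0: "polar h p p q0 \<noteq> 0"
    unfolding frechet_derivative_cubic[OF h] by (metis mult_zero_right)
  define q where "q = polar h p p q0 *\<^sub>R q0"
  have q: "polar h p p q > 0"
    using q0 by (simp add: q_def polar_scaleR[OF h] not_sum_power2_lt_zero flip: power2_eq_square)
  have "psd_one_dim_kernel_on {v. polar h p p v = 0} (\<lambda>u v. - hessian h p u v)"
    using reg p unfolding regular_boundary_behaviour_def tangent_space_frontier[OF h H p q, symmetric] by blast
  from boundary_frame[OF h hp q this dim]
  obtain M :: "real \<times> (real ^ 'k) \<times> real \<Rightarrow> real \<times> (real ^ 'k) \<times> real" where M: "linear M" "inj M"
    "M (1, 0, 0) = p" "3 * polar h p p (M (0, 0, 1)) = 1" "\<And>s. polar h p p (M (0, s, 0)) = 0"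
    "\<And>s. 3 * polar h p (M (0, s, 0)) (M (0, s, 0)) = - (s \<bullet> s)" by blast
  define l :: "nat \<Rightarrow> real" where "l n = inverse (real (Suc n))" for n
  have l: "filterlim l (at 0) sequentially" "l n \<noteq> 0" for n
    unfolding l_def filterlim_at using LIMSEQ_inverse_real_of_nat by auto
  define A where "A n = M \<circ> weighted_scaling (l n) \<circ> hbar_coordinates" for n
  have "linear (A n) \<and> inj (A n)" for n
    unfolding A_def using M(1,2) l(2)
    by (intro conjI linear_compose inj_compose linear_weighted_scaling inj_weighted_scaling
        linear_hbar_coordinates bij_is_inj[OF bij_hbar_coordinates])
  then have "linear (A n) \<and> bij (A n)" for n
    using linear_injective_imp_surjective by (auto simp: bij_def)
  moreover have "(\<lambda>n. h (A n x)) \<longlonglongrightarrow> hbar x" for x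
    using filterlim_compose[OF degeneration_to_model[OF h hp M(1,3-6), of "hbar_coordinates x"] l(1)]
    by (simp add: A_def hbar_eq_model)
  ultimately show ?thesis by blast
qed

lemma pointwise_limit_in_open:
  fixes f :: "nat \<Rightarrow> 'a \<Rightarrow> 'b::topological_space"
  assumes "open S" "g \<in> S" "\<And>x. (\<lambda>n. f n x) \<longlonglongrightarrow> g x"
  shows "\<exists>n. f n \<in> S"
proof -
  have "limitin (product_topology (\<lambda>_. euclidean) UNIV) f g sequentially"
    using assms(3) by (auto simp: limitin_componentwise)
  then have "f \<longlonglongrightarrow> g"
    by (simp add: euclidean_product_topology)
  then have "eventually (\<lambda>n. f n \<in> S) sequentially"
    using assms(1,2) topological_tendstoD by blast
  then show ?thesis by (meson eventually_sequentially order_refl)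
qed

theorem corollary1p16:
  shows "(hbar :: real \<times> (real ^ 'k) \<times> real \<Rightarrow> real) \<in> sym3_ccpsr \<and>
    (\<forall>P \<in> gl_orbit ` (sym3_ccpsr_reg :: (real \<times> (real ^ 'k) \<times> real \<Rightarrow> real) set).
      \<not> (\<exists>U V. openin ccpsr_orbit_space U \<and> openin ccpsr_orbit_space V \<and>
            gl_orbit hbar \<in> U \<and> P \<in> V \<and> U \<inter> V = {}))"
proof (intro conjI ballI notI)
  show "(hbar :: real \<times> (real ^ 'k) \<times> real \<Rightarrow> real) \<in> sym3_ccpsr" by (rule hbar_in_sym3_ccpsr)
  fix P :: "(real \<times> (real ^ 'k) \<times> real \<Rightarrow> real) set"
  assume "P \<in> gl_orbit ` sym3_ccpsr_reg"
  then obtain h :: "real \<times> (real ^ 'k) \<times> real \<Rightarrow> real" where h: "h \<in> sym3_ccpsr_reg" "P = gl_orbit h" by blast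
  then have hs: "h \<in> sym3_ccpsr" by (auto simp: sym3_ccpsr_reg_def sym3_ccpsr_def)
  assume "\<exists>U V. openin ccpsr_orbit_space U \<and> openin ccpsr_orbit_space V \<and>
            gl_orbit (hbar :: real \<times> (real ^ 'k) \<times> real \<Rightarrow> real) \<in> U \<and> P \<in> V \<and> U \<inter> V = {}"
  then obtain U V where U: "openin ccpsr_orbit_space U" "gl_orbit (hbar :: real \<times> (real ^ 'k) \<times> real \<Rightarrow> real) \<in> U"
    and V: "P \<in> V" "U \<inter> V = {}" by blast
  from U(1) have "openin (top_of_set sym3_ccpsr) {f \<in> sym3_ccpsr. gl_orbit f \<in> U}"
    by (simp add: ccpsr_orbit_space_def openin_quotient_topology)
  then obtain S where S: "open S" "{f \<in> sym3_ccpsr. gl_orbit f \<in> U} = sym3_ccpsr \<inter> S"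
    by (auto simp: openin_open)
  have "hbar \<in> S" using S(2) U(2) hbar_in_sym3_ccpsr by blast
  obtain A :: "nat \<Rightarrow> real \<times> (real ^ 'k) \<times> real \<Rightarrow> real \<times> (real ^ 'k) \<times> real"
    where A: "\<And>n. linear (A n)" "\<And>n. bij (A n)" "\<And>x. (\<lambda>n. h (A n x)) \<longlonglongrightarrow> hbar x"
    using orbit_of_regular_degenerates[OF h(1)] by blast
  obtain n where "h \<circ> A n \<in> S"
    using pointwise_limit_in_open[OF S(1) \<open>hbar \<in> S\<close>, of "\<lambda>n. h \<circ> A n"] A(3) by auto
  moreover have "h \<circ> A n \<in> sym3_ccpsr" by (rule sym3_ccpsr_compose[OF hs A(1,2)])
  ultimately have "gl_orbit (h \<circ> A n) \<in> U" using S(2) by blast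
  then have "P \<in> U" using h(2) gl_orbit_compose[OF A(1,2)] by simp
  then show False using V by blast
qed

end
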